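(* Let $u\colon \mathbb{R}^3\setminus\{0\}\to\mathbb{R}^3$ be a smooth vector field, not identically zero, which together with some smooth pressure function $p\colon\mathbb{R}^3\setminus\{0\}\to\mathbb{R}$ solves the steady-state Navier-Stokes equations $$-\Delta u+(u\cdot\nabla)u+\nabla p=0,\qquad \operatorname{div}u=0\qquad\text{in }\mathbb{R}^3\setminus\{0\},$$ and which satisfies $\lambda u(\lambda x)=u(x)$ for every $\lambda>0$ and every $x\in\mathbb{R}^3\setminus\{0\}$. Then $u$ is a Landau solution; that is, $u$ is axi-symmetric and there are a Cartesian (orthonormal) coordinate frame of $\mathbb{R}^3$ centered at the origin and a real number $\kappa\neq 0$ such that, in the spherical coordinates $(\theta,\psi)$ of this frame, for every $x\in S^2$, $$u(x)=\frac{-2\sin\theta}{\coth\kappa-\cos\theta}\,e_\theta(x)+\left(\frac{2}{(\cosh\kappa-\sinh\kappa\cos\theta)^2}-2\right)e(x).$$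
   Context: $S^2\subset\mathbb{R}^3$ is the unit sphere, and $e(x)=x$ is its outer unit normal at $x\in S^2$. Spherical coordinates $(\theta,\psi)$ on $S^2$ are given by $x_1=\sin\theta\cos\psi$, $x_2=\sin\theta\sin\psi$, $x_3=\cos\theta$, and $e_\theta=\partial x/\partial\theta$ is the corresponding (unit) tangent vector field; at the two poles, where $e_\theta$ is undefined, the term $\sin\theta\,e_\theta$ is understood as $0$. A vector field with $\lambda u(\lambda x)=u(x)$ for all $\lambda>0$ is determined by its restriction to $S^2$. The Landau solutions are the $(-1)$-homogeneous vector fields on $\mathbb{R}^3\setminus\{0\}$ whose restriction to $S^2$ is given, in a suitable coordinate frame, by the formula in the claim. *)

theory Defs
  imports "HOL-Analysis.Analysis"
begin

section \<open>Smooth functions\<close>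

text \<open>Intended for open \<open>S\<close>: \<open>Ck_on k f S\<close> says that \<open>f\<close> is \<open>k\<close> times continuously
  differentiable on \<open>S\<close>.\<close>

primrec Ck_on ::
    "nat \<Rightarrow> ('a::real_normed_vector \<Rightarrow> 'b::real_normed_vector) \<Rightarrow> 'a set \<Rightarrow> bool" where
  "Ck_on 0 f S \<longleftrightarrow> continuous_on S f"
| "Ck_on (Suc k) f S \<longleftrightarrow>
     (\<forall>x\<in>S. f differentiable (at x)) \<and>
     (\<forall>v. Ck_on k (\<lambda>x. frechet_derivative f (at x) v) S)"

definition smooth_on ::
    "('a::real_normed_vector \<Rightarrow> 'b::real_normed_vector) \<Rightarrow> 'a set \<Rightarrow> bool" where
  "smooth_on f S \<longleftrightarrow> (\<forall>k. Ck_on k f S)"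

section \<open>Differential operators and the steady Navier--Stokes system\<close>

definition partial ::
    "'n::finite \<Rightarrow> (real^'n \<Rightarrow> 'b::real_normed_vector) \<Rightarrow> real^'n \<Rightarrow> 'b" where
  "partial i f x = frechet_derivative f (at x) (axis i 1)"

definition laplacian :: "(real^'n::finite \<Rightarrow> 'b::real_normed_vector) \<Rightarrow> real^'n \<Rightarrow> 'b" where
  "laplacian f x = (\<Sum>i\<in>UNIV. partial i (partial i f) x)"

definition gradient :: "(real^'n::finite \<Rightarrow> real) \<Rightarrow> real^'n \<Rightarrow> real^'n" where
  "gradient p x = (\<chi> i. partial i p x)"

definition divergence :: "(real^'n::finite \<Rightarrow> real^'n) \<Rightarrow> real^'n \<Rightarrow> real" where
  "divergence u x = (\<Sum>i\<in>UNIV. partial i (\<lambda>y. u y $ i) x)"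

definition convection ::
    "(real^'n::finite \<Rightarrow> real^'n) \<Rightarrow> (real^'n \<Rightarrow> 'b::real_normed_vector) \<Rightarrow> real^'n \<Rightarrow> 'b" where
  "convection u w x = (\<Sum>i\<in>UNIV. u x $ i *\<^sub>R partial i w x)"

definition steady_navier_stokes_on ::
    "(real^3) set \<Rightarrow> (real^3 \<Rightarrow> real^3) \<Rightarrow> (real^3 \<Rightarrow> real) \<Rightarrow> bool" where
  "steady_navier_stokes_on S u p \<longleftrightarrow>
     (\<forall>x\<in>S. - laplacian u x + convection u u x + gradient p x = 0 \<and> divergence u x = 0)"

section \<open>Frames, spherical coordinates, axial symmetry\<close>

definition orthonormal_frame :: "(3 \<Rightarrow> real^3) \<Rightarrow> bool" where
  "orthonormal_frame b \<longleftrightarrow> (\<forall>i j. b i \<bullet> b j = (if i = j then 1 else 0))"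

definition spherical_point :: "(3 \<Rightarrow> real^3) \<Rightarrow> real \<Rightarrow> real \<Rightarrow> real^3" where
  "spherical_point b \<theta> \<psi> =
     (sin \<theta> * cos \<psi>) *\<^sub>R b 1 + (sin \<theta> * sin \<psi>) *\<^sub>R b 2 + cos \<theta> *\<^sub>R b 3"

text \<open>At the poles the value of \<open>e_theta\<close> depends on \<open>\<psi>\<close> (it is not a vector field there), but
  \<open>sin \<theta> *\<^sub>R e_theta b \<theta> \<psi>\<close> is \<open>0\<close>.\<close>

definition e_theta :: "(3 \<Rightarrow> real^3) \<Rightarrow> real \<Rightarrow> real \<Rightarrow> real^3" where
  "e_theta b \<theta> \<psi> = vector_derivative (\<lambda>t. spherical_point b t \<psi>) (at \<theta>)"

definition axisymmetric_about :: "real^3 \<Rightarrow> (real^3 \<Rightarrow> real^3) \<Rightarrow> bool" where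
  "axisymmetric_about a u \<longleftrightarrow>
     (\<forall>Q. rotation_matrix Q \<and> Q *v a = a \<longrightarrow> (\<forall>x. x \<noteq> 0 \<longrightarrow> u (Q *v x) = Q *v u x))"

definition coth :: "real \<Rightarrow> real" where
  "coth x = cosh x / sinh x"

lemma e_theta_eq:
  "e_theta b \<theta> \<psi> =
     (cos \<theta> * cos \<psi>) *\<^sub>R b 1 + (cos \<theta> * sin \<psi>) *\<^sub>R b 2 - sin \<theta> *\<^sub>R b 3"
  unfolding e_theta_def spherical_point_def
  by (rule vector_derivative_at) (auto intro!: derivative_eq_intros)

text \<open>Every point of the unit sphere has spherical coordinates with respect to every frame.\<close>

lemma spherical_point_image:
  assumes "orthonormal_frame b"
  shows "(\<lambda>(\<theta>, \<psi>). spherical_point b \<theta> \<psi>) ` ({0..pi} \<times> {0..<2 * pi}) = sphere 0 1"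
proof -
  have b: "b i \<bullet> b j = (if i = j then 1 else 0)" for i j
    using assms by (simp add: orthonormal_frame_def)
  show ?thesis
  proof (intro equalityI subsetI)
    fix x assume "x \<in> (\<lambda>(\<theta>, \<psi>). spherical_point b \<theta> \<psi>) ` ({0..pi} \<times> {0..<2 * pi})"
    then obtain \<theta> \<psi> where x: "x = spherical_point b \<theta> \<psi>" by auto
    have "x \<bullet> x = (sin \<theta>)\<^sup>2 * ((cos \<psi>)\<^sup>2 + (sin \<psi>)\<^sup>2) + (cos \<theta>)\<^sup>2"
      unfolding x spherical_point_def
      by (simp add: inner_simps b power2_eq_square distrib_left mult_ac del: sin_cos_squared_add
          sin_cos_squared_add2 sin_cos_squared_add3)
    then show "x \<in> sphere 0 1" by (simp add: norm_eq_1)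
  next
    fix x :: "real^3" assume x: "x \<in> sphere 0 1"
    have "inj b" using b by (metis injI zero_neq_one)
    have bB: "pairwise orthogonal (range b)" "\<And>v. v \<in> range b \<Longrightarrow> norm v = 1"
      using b by (auto simp: pairwise_def orthogonal_def norm_eq_1)
    have "0 \<notin> range b" using bB(2)[of 0] by auto
    then have "independent (range b)" by (rule pairwise_orthogonal_independent[OF bB(1)])
    moreover have "card (range b) = 3" using \<open>inj b\<close> by (simp add: card_image)
    ultimately have "UNIV \<subseteq> span (range b)"
      by (intro card_ge_dim_independent) auto
    then have "x \<in> span (range b)" by blast
    then have "x = (\<Sum>v\<in>range b. (x \<bullet> v) *\<^sub>R v)"
      using bB by (intro orthonormal_basis_expand[symmetric]) auto
    also have "\<dots> = (\<Sum>i\<in>UNIV. (x \<bullet> b i) *\<^sub>R b i)"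
      by (rule sum.reindex_cong[OF \<open>inj b\<close>]) auto
    also have "\<dots> = (x \<bullet> b 1) *\<^sub>R b 1 + (x \<bullet> b 2) *\<^sub>R b 2 + (x \<bullet> b 3) *\<^sub>R b 3"
      by (rule sum_3)
    finally have xe: "x = (x \<bullet> b 1) *\<^sub>R b 1 + (x \<bullet> b 2) *\<^sub>R b 2 + (x \<bullet> b 3) *\<^sub>R b 3" .
    define c1 c2 c3 where c: "c1 = x \<bullet> b 1" "c2 = x \<bullet> b 2" "c3 = x \<bullet> b 3"
    have "x \<bullet> x = c1\<^sup>2 + c2\<^sup>2 + c3\<^sup>2"
      by (subst (2) xe) (simp only: inner_simps c power2_eq_square)
    then have s: "c1\<^sup>2 + c2\<^sup>2 + c3\<^sup>2 = 1" using x by (simp add: norm_eq_1)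
    obtain \<theta> where th: "0 \<le> \<theta>" "\<theta> \<le> pi" "c3 = cos \<theta>" "sqrt (c1\<^sup>2 + c2\<^sup>2) = sin \<theta>"
      using sincos_total_pi[of "sqrt (c1\<^sup>2 + c2\<^sup>2)" c3] s by (auto simp: add.commute)
    obtain \<psi> where ps: "0 \<le> \<psi>" "\<psi> < 2 * pi" "c1 = sin \<theta> * cos \<psi>" "c2 = sin \<theta> * sin \<psi>"
    proof (cases "sin \<theta> = 0")
      case True
      then have "c1\<^sup>2 + c2\<^sup>2 = 0" using th(4) by simp
      then show ?thesis using True that[of 0] by (simp add: sum_power2_eq_zero_iff)
    next
      case False
      have "c1\<^sup>2 + c2\<^sup>2 = (sin \<theta>)\<^sup>2" by (metis th(4) real_sqrt_pow2 sum_power2_ge_zero)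
      then have "(c1 / sin \<theta>)\<^sup>2 + (c2 / sin \<theta>)\<^sup>2 = 1"
        using False by (simp add: power_divide flip: add_divide_distrib)
      then obtain t where "0 \<le> t" "t < 2 * pi" "c1 / sin \<theta> = cos t" "c2 / sin \<theta> = sin t"
        using sincos_total_2pi by metis
      then show ?thesis using that[of t] False by (simp add: field_simps)
    qed
    have "x = spherical_point b \<theta> \<psi>"
      unfolding spherical_point_def by (subst xe) (simp only: ps(3,4) th(3) flip: c)
    then show "x \<in> (\<lambda>(\<theta>, \<psi>). spherical_point b \<theta> \<psi>) ` ({0..pi} \<times> {0..<2 * pi})"
      using ps th by force
  qed
qed

end

theory Submission
  imports Defs
begin

text \<open>The pressure enters only through \<open>x \<bullet> \<nabla>p\<close>, and three functions homogeneous of degree \<open>0\<close> turn out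
  to be constant by the strong maximum principle on the sphere. With \<open>f = x \<bullet> u\<close> and
  \<open>z = x \<bullet> curl u\<close>, the function \<open>B = |x|\<^sup>2 (|u|\<^sup>2 - x \<bullet> \<nabla>p) - f\<^sup>2 - 2 f\<close> satisfies
  \<open>\<Delta>B - u \<bullet> \<nabla>B = 2 z\<^sup>2\<close>, so \<open>z = 0\<close> and the tangential part of \<open>u\<close> is a gradient \<open>\<nabla>\<phi>\<close>. Next
  \<open>g = (f + 2) exp (- \<phi>)\<close> satisfies \<open>\<Delta>g + \<nabla>\<phi> \<bullet> \<nabla>g = - B exp (- \<phi>) / |x|\<^sup>2\<close>, so \<open>g\<close> is a constant
  \<open>A\<close>; this is the Liouville equation for \<open>\<phi>\<close>. Finally \<open>F = |x| exp (- \<phi> / 2)\<close> is homogeneous of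
  degree \<open>1\<close> with \<open>F \<Delta>F = |\<nabla>F|\<^sup>2 + A / 2\<close>, whence \<open>F \<Delta>\<Delta>F = 2 |\<nabla>\<^sup>2F|\<^sup>2 - (\<Delta>F)\<^sup>2 \<ge> 0\<close>; so
  \<open>|x| \<Delta>F\<close> is constant, equality holds, and \<open>F = \<alpha> |x| + b \<bullet> x\<close>.\<close>

section \<open>Calculus of smooth functions\<close>

text \<open>On the unit sphere a function of degree \<open>0\<close> has the same Laplacian in space
  as along the sphere, so homogeneous functions in space replace charts and covariant derivatives.
  The pressure is not assumed homogeneous; the equations only force this on its gradient, of degree
  \<open>-3\<close>. Up to an additive constant \<open>p\<close> equals
  \<open>- x \<bullet> \<nabla>p / 2\<close>, so \<open>|u|\<^sup>2 - x \<bullet> \<nabla>p\<close>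
  is, up to that constant, twice the Bernoulli head \<open>|u|\<^sup>2 / 2 + p\<close>. The constant
  value of \<open>B\<close> has no sign known in advance; \<open>g\<close> is then a sub- or a
  supersolution, and either is enough. Geometrically \<open>g\<close> is twice the Gauss curvature
  of the round metric multiplied by \<open>exp \<phi>\<close>, because the spherical Laplacian of
  \<open>\<phi>\<close> is \<open>- f\<close>. Its constancy is therefore a statement about metrics
  of constant curvature on the sphere, and on the sphere \<open>F\<close> is the function whose
  power \<open>F^(-2)\<close> is the conformal factor. The vanishing of the trace-free Hessian of
  \<open>F\<close>, an argument of Obata type, takes the place of a complex developing map.\<close>

lemma Ck_on_cong:
  assumes "open S" "\<And>x. x \<in> S \<Longrightarrow> f x = g x"
  shows "Ck_on k f S \<longleftrightarrow> Ck_on k g S"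
proof -
  have *: "Ck_on k f S \<Longrightarrow> Ck_on k g S" if "\<And>x. x \<in> S \<Longrightarrow> f x = g x" for k f g
    using that
  proof (induction k arbitrary: f g)
    case 0
    then show ?case by (simp cong: continuous_on_cong)
  next
    case (Suc k)
    have d: "(f has_derivative D) (at x) \<longleftrightarrow> (g has_derivative D) (at x)" if "x \<in> S" for x D
      using Suc.prems(2) that assms(1)
      by (metis (mono_tags, lifting) has_derivative_transform_within_open)
    then have "frechet_derivative f (at x) = frechet_derivative g (at x)" if "x \<in> S" for x
      using that by (simp add: frechet_derivative_def)
    then have "Ck_on k (\<lambda>x. frechet_derivative g (at x) v) S" for v
      using Suc.prems Suc.IH[of "\<lambda>x. frechet_derivative f (at x) v" "\<lambda>x. frechet_derivative g (at x) v"]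
      by simp
    moreover have "g differentiable (at x)" if "x \<in> S" for x
      using Suc.prems(1) d[OF that] that unfolding differentiable_def by (metis Ck_on.simps(2) differentiable_def)
    ultimately show ?case by simp
  qed
  show ?thesis using * assms(2) by metis
qed

text \<open>Any explicit derivative may stand in for the choice-based
  \<open>frechet_derivative\<close>. The closure properties that follow are inductions on
  \<open>k\<close> feeding the usual differentiation rules to this one.\<close>

lemma Ck_on_SucI:
  assumes "open S" "\<And>x. x \<in> S \<Longrightarrow> (f has_derivative f' x) (at x)"
    and "\<And>v. Ck_on k (\<lambda>x. f' x v) S"
  shows "Ck_on (Suc k) f S"
proof -
  have "frechet_derivative f (at x) = f' x" if "x \<in> S" for x
    using assms(2)[OF that] by (metis frechet_derivative_at)
  then have "Ck_on k (\<lambda>x. frechet_derivative f (at x) v) S" for v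
    using assms(3)[of v] Ck_on_cong[OF assms(1), of "\<lambda>x. frechet_derivative f (at x) v" "\<lambda>x. f' x v" k]
    by simp
  then show ?thesis using assms(2) by (auto simp: differentiable_def)
qed

lemma Ck_on_Suc_has_derivative:
  assumes "Ck_on (Suc k) f S" "x \<in> S"
  shows "(f has_derivative frechet_derivative f (at x)) (at x)"
  using assms by (auto simp: frechet_derivative_works)

lemma Ck_on_SucD: "Ck_on (Suc k) f S \<Longrightarrow> Ck_on k f S"
proof (induction k arbitrary: f)
  case 0
  then show ?case
    by (auto intro!: differentiable_imp_continuous_on simp: differentiable_on_def differentiable_at_withinI)
next
  case (Suc k)
  then show ?case by auto
qed

lemma Ck_on_const: "open S \<Longrightarrow> Ck_on k (\<lambda>x. c) S"
proof (induction k arbitrary: c)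
  case (Suc k)
  then show ?case by (intro Ck_on_SucI[where f'="\<lambda>x v. 0"]) auto
qed auto

lemma Ck_on_bounded_linear_comp:
  assumes "open S" "bounded_linear L"
  shows "Ck_on k f S \<Longrightarrow> Ck_on k (\<lambda>x. L (f x)) S"
proof (induction k arbitrary: f)
  case 0
  then show ?case using assms by (auto intro: bounded_linear.continuous_on)
next
  case (Suc k)
  show ?case
    by (rule Ck_on_SucI[OF assms(1) bounded_linear.has_derivative[OF assms(2)
            Ck_on_Suc_has_derivative[OF Suc.prems]]])
      (use Suc in auto)
qed

lemma Ck_on_add:
  assumes "open S"
  shows "Ck_on k f S \<Longrightarrow> Ck_on k g S \<Longrightarrow> Ck_on k (\<lambda>x. f x + g x) S"
proof (induction k arbitrary: f g)
  case 0
  then show ?case by (auto intro: continuous_intros)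
next
  case (Suc k)
  show ?case
    by (rule Ck_on_SucI[OF assms has_derivative_add[OF Ck_on_Suc_has_derivative[OF Suc.prems(1)]
            Ck_on_Suc_has_derivative[OF Suc.prems(2)]]])
      (use Suc in auto)
qed

lemma Ck_on_mult:
  fixes f g :: "'a::real_normed_vector \<Rightarrow> real"
  assumes "open S"
  shows "Ck_on k f S \<Longrightarrow> Ck_on k g S \<Longrightarrow> Ck_on k (\<lambda>x. f x * g x) S"
proof (induction k arbitrary: f g)
  case 0
  then show ?case by (auto intro: continuous_intros)
next
  case (Suc k)
  show ?case
    by (rule Ck_on_SucI[OF assms has_derivative_mult[OF Ck_on_Suc_has_derivative[OF Suc.prems(1)]
            Ck_on_Suc_has_derivative[OF Suc.prems(2)]]])
      (use Suc Suc.prems[THEN Ck_on_SucD] in \<open>auto intro!: Ck_on_add[OF assms]\<close>)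
qed

lemma Ck_on_bounded_linear:
  assumes "open S" "bounded_linear L"
  shows "Ck_on k L S"
proof (cases k)
  case 0
  then show ?thesis using assms by (auto intro: linear_continuous_on)
next
  case (Suc k)
  show ?thesis unfolding Suc
    by (rule Ck_on_SucI[OF assms(1) bounded_linear_imp_has_derivative[OF assms(2)]])
      (rule Ck_on_const[OF assms(1)])
qed

lemma Ck_on_exp:
  fixes f :: "'a::real_normed_vector \<Rightarrow> real"
  assumes "open S"
  shows "Ck_on k f S \<Longrightarrow> Ck_on k (\<lambda>x. exp (f x)) S"
proof (induction k arbitrary: f)
  case 0
  then show ?case by (auto intro: continuous_intros)
next
  case (Suc k)
  show ?case
    by (rule Ck_on_SucI[OF assms has_derivative_exp[OF Ck_on_Suc_has_derivative[OF Suc.prems]]])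
      (use Suc Suc.prems[THEN Ck_on_SucD] in \<open>auto intro!: Ck_on_mult[OF assms]\<close>)
qed

lemma Ck_on_inverse:
  fixes f :: "'a::real_normed_vector \<Rightarrow> real"
  assumes "open S" "\<And>x. x \<in> S \<Longrightarrow> f x \<noteq> 0"
  shows "Ck_on k f S \<Longrightarrow> Ck_on k (\<lambda>x. inverse (f x)) S"
proof (induction k)
  case 0
  then show ?case using assms(2) by (auto intro: continuous_intros)
next
  case (Suc k)
  have d: "((\<lambda>x. inverse (f x)) has_derivative
      (\<lambda>v. (- 1) * (inverse (f x) * frechet_derivative f (at x) v * inverse (f x)))) (at x)" if "x \<in> S" for x
    using Deriv.has_derivative_inverse[OF assms(2)[OF that] Ck_on_Suc_has_derivative[OF Suc.prems that]]
    by simp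
  show ?case
  proof (rule Ck_on_SucI[OF assms(1) d])
    fix v
    show "Ck_on k (\<lambda>x. (- 1) * (inverse (f x) * frechet_derivative f (at x) v * inverse (f x))) S"
      by (intro Ck_on_mult Ck_on_const assms(1) Suc.IH Suc.prems[THEN Ck_on_SucD])
        (use Suc.prems in auto)
  qed
qed

lemma Ck_on_norm:
  "Ck_on k (norm :: 'a::real_inner \<Rightarrow> real) (- {0})"
proof (induction k)
  case 0
  then show ?case by (auto intro: continuous_intros)
next
  case (Suc k)
  have o: "open (- {0::'a})" by auto
  show ?case
  proof (rule Ck_on_SucI[OF o, where f'="\<lambda>x v. (x \<bullet> v) * inverse (norm x)"])
    fix x :: 'a assume "x \<in> - {0}"
    then show "(norm has_derivative (\<lambda>v. (x \<bullet> v) * inverse (norm x))) (at x)"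
      by (intro has_derivative_eq_rhs[OF has_derivative_norm])
        (auto simp: sgn_div_norm fun_eq_iff inner_commute)
  next
    fix v :: 'a
    show "Ck_on k (\<lambda>x. (x \<bullet> v) * inverse (norm x)) (- {0})"
      by (intro Ck_on_mult[OF o] Ck_on_inverse[OF o] Suc Ck_on_bounded_linear[OF o]
          bounded_linear_inner_left) auto
  qed
qed

lemma smooth_on_frechet_derivative:
  "smooth_on f S \<Longrightarrow> smooth_on (\<lambda>x. frechet_derivative f (at x) v) S"
  unfolding smooth_on_def using Ck_on.simps(2) by blast

lemma smooth_on_partial: "smooth_on f S \<Longrightarrow> smooth_on (partial i f) S"
  unfolding partial_def[abs_def] by (rule smooth_on_frechet_derivative)

lemma smooth_on_has_derivative:
  "smooth_on f S \<Longrightarrow> x \<in> S \<Longrightarrow> (f has_derivative frechet_derivative f (at x)) (at x)"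
  unfolding smooth_on_def by (metis Ck_on_Suc_has_derivative)

lemma smooth_on_imp_continuous_on: "smooth_on f S \<Longrightarrow> continuous_on S f"
  unfolding smooth_on_def by (metis Ck_on.simps(1))

lemma smooth_onI_derivative:
  assumes "open S" "\<And>x. x \<in> S \<Longrightarrow> (f has_derivative f' x) (at x)"
    and "\<And>v. smooth_on (\<lambda>x. f' x v) S"
  shows "smooth_on f S"
  unfolding smooth_on_def
  using Ck_on_SucI[OF assms(1,2)] assms(3) Ck_on_SucD by (metis smooth_on_def)

lemma smooth_on_cong:
  "open S \<Longrightarrow> (\<And>x. x \<in> S \<Longrightarrow> f x = g x) \<Longrightarrow> smooth_on f S \<longleftrightarrow> smooth_on g S"
  unfolding smooth_on_def using Ck_on_cong by metis

lemma partial_unique: "(f has_derivative f') (at x) \<Longrightarrow> partial i f x = f' (axis i 1)"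
  unfolding partial_def by (metis frechet_derivative_at)

lemma frechet_derivative_partial:
  fixes f :: "real^'n \<Rightarrow> real"
  assumes "f differentiable (at x)"
  shows "frechet_derivative f (at x) v = (\<Sum>i\<in>UNIV. v $ i * partial i f x)"
proof -
  have "linear (frechet_derivative f (at x))"
    using assms linear_frechet_derivative by blast
  then have "frechet_derivative f (at x) (\<Sum>i\<in>UNIV. v $ i *\<^sub>R axis i 1) = (\<Sum>i\<in>UNIV. v $ i * partial i f x)"
    by (simp add: linear_sum linear_scale partial_def)
  then show ?thesis using basis_expansion[of v] by (simp add: scalar_mult_eq_scaleR)
qed

section \<open>Symmetry of second partial derivatives\<close>

lemma smooth_on_line_derivative:
  fixes f :: "real^'n \<Rightarrow> real"
  assumes "smooth_on f S" "x + t *\<^sub>R axis i 1 \<in> S"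
  shows "((\<lambda>t. f (x + t *\<^sub>R axis i 1)) has_real_derivative partial i f (x + t *\<^sub>R axis i 1)) (at t)"
proof -
  have "((\<lambda>t. f (x + t *\<^sub>R axis i 1)) has_derivative
     (\<lambda>s. frechet_derivative f (at (x + t *\<^sub>R axis i 1)) (s *\<^sub>R axis i 1))) (at t)"
    by (rule has_derivative_compose[of "\<lambda>t. x + t *\<^sub>R axis i 1" _ _ UNIV f])
      (auto intro!: derivative_eq_intros smooth_on_has_derivative[OF assms])
  moreover have "frechet_derivative f (at (x + t *\<^sub>R axis i 1)) (s *\<^sub>R axis i 1)
      = partial i f (x + t *\<^sub>R axis i 1) * s" for s
    using has_derivative_linear[OF smooth_on_has_derivative[OF assms]]
    by (simp add: linear_scale partial_def)
  ultimately show ?thesis by (simp add: has_field_derivative_def)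
qed

text \<open>The mean value theorem is applied twice, in direction \<open>i\<close> to a difference
  of two parallel edges and then in direction \<open>j\<close>. The radius \<open>2 * h\<close>
  bounds the distance from \<open>x\<close> to any point of the square with side
  \<open>h\<close>.\<close>

lemma mixed_difference:
  fixes f :: "real^'n \<Rightarrow> real"
  assumes f: "smooth_on f S" and S: "cball x (2 * h) \<subseteq> S" and h: "h > 0"
  shows "\<exists>y\<in>cball x (2 * h). f (x + h *\<^sub>R axis i 1 + h *\<^sub>R axis j 1) - f (x + h *\<^sub>R axis i 1)
      - f (x + h *\<^sub>R axis j 1) + f x = h\<^sup>2 * partial j (partial i f) y"
proof -
  let ?ei = "axis i 1 :: real^'n" and ?ej = "axis j 1 :: real^'n"
  have inS: "x + s *\<^sub>R ?ei + t *\<^sub>R ?ej \<in> cball x (2 * h)" if "0 \<le> s" "s \<le> h" "0 \<le> t" "t \<le> h" for s t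
  proof -
    have "dist x (x + s *\<^sub>R ?ei + t *\<^sub>R ?ej) = norm (s *\<^sub>R ?ei + t *\<^sub>R ?ej)"
      by (metis add.assoc add_diff_cancel_left' dist_commute dist_norm)
    also have "\<dots> \<le> norm (s *\<^sub>R ?ei) + norm (t *\<^sub>R ?ej)" by (rule norm_triangle_ineq)
    also have "\<dots> \<le> 2 * h" using that by simp
    finally show ?thesis by simp
  qed
  have "\<exists>s. s > 0 \<and> s < h \<and>
     (f (x + h *\<^sub>R ?ej + h *\<^sub>R ?ei) - f (x + h *\<^sub>R ?ei)) - (f (x + h *\<^sub>R ?ej + 0 *\<^sub>R ?ei) - f (x + 0 *\<^sub>R ?ei))
     = (h - 0) * (partial i f (x + h *\<^sub>R ?ej + s *\<^sub>R ?ei) - partial i f (x + s *\<^sub>R ?ei))"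
  proof (rule MVT2[OF h])
    fix s assume s: "0 \<le> s" "s \<le> h"
    have "x + h *\<^sub>R ?ej + s *\<^sub>R ?ei \<in> S" "x + s *\<^sub>R ?ei \<in> S"
      using inS[of s h] inS[of s 0] s S h by (auto simp: add_ac)
    then show "((\<lambda>s. f (x + h *\<^sub>R ?ej + s *\<^sub>R ?ei) - f (x + s *\<^sub>R ?ei)) has_real_derivative
       partial i f (x + h *\<^sub>R ?ej + s *\<^sub>R ?ei) - partial i f (x + s *\<^sub>R ?ei)) (at s)"
      by (intro DERIV_diff smooth_on_line_derivative[OF f])
  qed
  then obtain s where s: "s > 0" "s < h" and e1:
     "f (x + h *\<^sub>R ?ei + h *\<^sub>R ?ej) - f (x + h *\<^sub>R ?ei) - f (x + h *\<^sub>R ?ej) + f x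
      = h * (partial i f (x + s *\<^sub>R ?ei + h *\<^sub>R ?ej) - partial i f (x + s *\<^sub>R ?ei + 0 *\<^sub>R ?ej))"
    by (auto simp: add_ac algebra_simps)
  have "\<exists>t. t > 0 \<and> t < h \<and>
     partial i f (x + s *\<^sub>R ?ei + h *\<^sub>R ?ej) - partial i f (x + s *\<^sub>R ?ei + 0 *\<^sub>R ?ej)
     = (h - 0) * partial j (partial i f) (x + s *\<^sub>R ?ei + t *\<^sub>R ?ej)"
  proof (rule MVT2[OF h])
    fix t assume t: "0 \<le> t" "t \<le> h"
    have "x + s *\<^sub>R ?ei + t *\<^sub>R ?ej \<in> S"
      using inS[of s t] s t S h by auto
    then show "((\<lambda>t. partial i f (x + s *\<^sub>R ?ei + t *\<^sub>R ?ej)) has_real_derivative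
       partial j (partial i f) (x + s *\<^sub>R ?ei + t *\<^sub>R ?ej)) (at t)"
      by (intro smooth_on_line_derivative[OF smooth_on_partial[OF f]])
  qed
  then obtain t where t: "t > 0" "t < h" and e2:
     "partial i f (x + s *\<^sub>R ?ei + h *\<^sub>R ?ej) - partial i f (x + s *\<^sub>R ?ei + 0 *\<^sub>R ?ej)
     = h * partial j (partial i f) (x + s *\<^sub>R ?ei + t *\<^sub>R ?ej)" by auto
  show ?thesis
    using inS[of s t] s t
    by (intro bexI[of _ "x + s *\<^sub>R ?ei + t *\<^sub>R ?ej"]) (simp_all add: e1 e2[simplified] power2_eq_square)
qed

text \<open>The second difference over a square is symmetric in \<open>i\<close> and
  \<open>j\<close>, so both mixed derivatives take a common value at points arbitrarily close to
  \<open>x\<close>; continuity carries this to \<open>x\<close>.\<close>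

lemma partial_commute:
  fixes f :: "real^'n \<Rightarrow> real"
  assumes f: "smooth_on f S" and S: "open S" and x: "x \<in> S"
  shows "partial i (partial j f) x = partial j (partial i f) x"
proof (rule ccontr)
  let ?a = "partial i (partial j f)" and ?b = "partial j (partial i f)"
  assume ne: "?a x \<noteq> ?b x"
  define e where "e = \<bar>?a x - ?b x\<bar> / 2"
  have e: "e > 0" using ne by (simp add: e_def)
  have "isCont ?a x" "isCont ?b x"
    using f S x by (auto intro!: continuous_on_interior[of S] smooth_on_imp_continuous_on smooth_on_partial
        simp: interior_open)
  then obtain d1 d2 where d: "d1 > 0" "d2 > 0"
    "\<And>y. dist y x < d1 \<Longrightarrow> dist (?a y) (?a x) < e"
    "\<And>y. dist y x < d2 \<Longrightarrow> dist (?b y) (?b x) < e"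
    using e unfolding continuous_at_eps_delta by metis
  obtain d3 where d3: "d3 > 0" "ball x d3 \<subseteq> S" using S x open_contains_ball by metis
  define h where "h = min d1 (min d2 d3) / 4"
  have h: "h > 0" "2 * h < d1" "2 * h < d2" "2 * h < d3"
    using d d3 by (auto simp: h_def min_def)
  then have hS: "cball x (2 * h) \<subseteq> S" using d3 by fastforce
  obtain y where y: "y \<in> cball x (2 * h)" "f (x + h *\<^sub>R axis i 1 + h *\<^sub>R axis j 1) - f (x + h *\<^sub>R axis i 1)
      - f (x + h *\<^sub>R axis j 1) + f x = h\<^sup>2 * ?b y"
    using mixed_difference[OF f hS h(1)] by blast
  obtain z where z: "z \<in> cball x (2 * h)" "f (x + h *\<^sub>R axis j 1 + h *\<^sub>R axis i 1) - f (x + h *\<^sub>R axis j 1)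
      - f (x + h *\<^sub>R axis i 1) + f x = h\<^sup>2 * ?a z"
    using mixed_difference[OF f hS h(1)] by blast
  have "h\<^sup>2 * ?a z = h\<^sup>2 * ?b y"
    unfolding y(2)[symmetric] z(2)[symmetric] by (simp add: add_ac)
  then have "?a z = ?b y" using h by simp
  moreover have "dist (?a z) (?a x) < e" "dist (?b y) (?b x) < e"
    using y(1) z(1) h d(3)[of z] d(4)[of y] by (simp_all add: dist_commute)
  ultimately have "dist (?a x) (?b x) < e + e"
    by (metis add_strict_mono dist_triangle3 order_le_less_trans)
  then show False by (simp add: e_def dist_real_def)
qed

lemma smooth_on_const: "open S \<Longrightarrow> smooth_on (\<lambda>x. c) S"
  by (simp add: smooth_on_def Ck_on_const)

lemma smooth_on_exp:
  fixes f :: "'a::real_normed_vector \<Rightarrow> real"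
  shows "open S \<Longrightarrow> smooth_on f S \<Longrightarrow> smooth_on (\<lambda>x. exp (f x)) S"
  by (simp add: smooth_on_def Ck_on_exp)

lemma smooth_on_inverse:
  fixes f :: "'a::real_normed_vector \<Rightarrow> real"
  shows "open S \<Longrightarrow> smooth_on f S \<Longrightarrow> (\<And>x. x \<in> S \<Longrightarrow> f x \<noteq> 0) \<Longrightarrow> smooth_on (\<lambda>x. inverse (f x)) S"
  by (simp add: smooth_on_def Ck_on_inverse)

section \<open>The differential ring of smooth functions on the punctured space\<close>

text \<open>Fixing the value at the origin turns identities that hold away from the origin into equations
  in a commutative ring with the derivations \<open>D i\<close>.\<close>

typedef sfun = "{f :: real^3 \<Rightarrow> real. smooth_on f (- {0}) \<and> f 0 = 0}"
  morphisms ev Abs_sfun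
  by (rule exI[of _ "\<lambda>x. 0"]) (simp add: smooth_on_const open_Compl)

setup_lifting type_definition_sfun

lemma open_punctured [simp]: "open (- {0::real^3})"
  by auto

lemma smooth_punctured_if:
  fixes f :: "real^3 \<Rightarrow> real"
  assumes "smooth_on f (- {0})"
  shows "smooth_on (\<lambda>x. if x = 0 then 0 else f x) (- {0})"
  using assms smooth_on_cong[OF open_punctured, of "\<lambda>x. if x = 0 then 0 else f x" f] by simp

lemma ev_0 [simp]: "ev a 0 = 0"
  using ev[of a] by simp

lemma ev_smooth: "smooth_on (ev a) (- {0})"
  using ev[of a] by simp

lemma sfun_eqI: "(\<And>x. x \<noteq> 0 \<Longrightarrow> ev a x = ev b x) \<Longrightarrow> a = b"
  by (metis ev_0 ev_inject ext)

instantiation sfun :: comm_ring_1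
begin

lift_definition zero_sfun :: sfun is "\<lambda>x. 0"
  by (simp add: smooth_on_const)

lift_definition one_sfun :: sfun is "\<lambda>x. if x = 0 then 0 else 1"
  by (simp add: smooth_punctured_if smooth_on_const)

lift_definition plus_sfun :: "sfun \<Rightarrow> sfun \<Rightarrow> sfun" is "\<lambda>f g x. f x + g x"
  by (simp add: smooth_on_def Ck_on_add)

lift_definition times_sfun :: "sfun \<Rightarrow> sfun \<Rightarrow> sfun" is "\<lambda>f g x. f x * g x"
  by (simp add: smooth_on_def Ck_on_mult)

lift_definition uminus_sfun :: "sfun \<Rightarrow> sfun" is "\<lambda>f x. - f x"
  by (simp add: smooth_on_def Ck_on_bounded_linear_comp bounded_linear_minus[OF bounded_linear_ident])

definition minus_sfun :: "sfun \<Rightarrow> sfun \<Rightarrow> sfun" where "minus_sfun f g = f + - g"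

instance
proof
  show "(0::sfun) \<noteq> 1"
    by transfer (metis axis_eq_0_iff zero_neq_one)
qed (simp only: minus_sfun_def | transfer, auto simp: algebra_simps)+

end

lift_definition cst :: "real \<Rightarrow> sfun" is "\<lambda>c x. if x = 0 then 0 else c"
  by (simp add: smooth_punctured_if smooth_on_const)

lift_definition X :: "3 \<Rightarrow> sfun" is "\<lambda>i x. x $ i"
  by (simp add: smooth_on_def Ck_on_bounded_linear bounded_linear_vec_nth)

lift_definition rad :: sfun is norm
  by (simp add: smooth_on_def Ck_on_norm)

lift_definition D :: "3 \<Rightarrow> sfun \<Rightarrow> sfun" is "\<lambda>i f x. if x = 0 then 0 else partial i f x"
  by (simp add: smooth_punctured_if smooth_on_partial)

lift_definition expf :: "sfun \<Rightarrow> sfun" is "\<lambda>f x. if x = 0 then 0 else exp (f x)"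
  by (simp add: smooth_punctured_if smooth_on_exp)

text \<open>If \<open>f\<close> vanishes anywhere off the origin the result is \<open>0\<close>
  everywhere, so that it is smooth in every case; otherwise it is the reciprocal, and
  \<open>inverse 0 = 0\<close> gives the required value at the origin.\<close>

lift_definition invf :: "sfun \<Rightarrow> sfun"
  is "\<lambda>f x. if \<exists>y. y \<noteq> 0 \<and> f y = 0 then 0 else inverse (f x)"
proof -
  fix f :: "real^3 \<Rightarrow> real"
  assume f: "smooth_on f (- {0}) \<and> f 0 = 0"
  show "smooth_on (\<lambda>x. if \<exists>y. y \<noteq> 0 \<and> f y = 0 then 0 else inverse (f x)) (- {0}) \<and>
      (if \<exists>y. y \<noteq> 0 \<and> f y = 0 then 0 else inverse (f 0)) = 0"
  proof (cases "\<exists>y. y \<noteq> 0 \<and> f y = 0")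
    case False
    then have "smooth_on (\<lambda>x. inverse (f x)) (- {0})"
      using f by (intro smooth_on_inverse) auto
    then show ?thesis using f False by (simp only: if_False) simp
  qed (simp add: smooth_on_const)
qed

lemma ev_simps [simp]:
  "ev 0 x = 0" "ev (a + b) x = ev a x + ev b x" "ev (a * b) x = ev a x * ev b x"
  "ev (- a) x = - ev a x" "ev (a - b) x = ev a x - ev b x" "ev (X i) x = x $ i" "ev rad x = norm x"
  unfolding minus_sfun_def by (transfer; simp)+

lemma ev_nz_simps:
  assumes "x \<noteq> 0"
  shows "ev 1 x = 1" "ev (cst c) x = c" "ev (expf a) x = exp (ev a x)"
  using assms by (transfer; simp)+

lemma cst_simps: "cst (a + b) = cst a + cst b" "cst (a * b) = cst a * cst b" "cst (- a) = - cst a"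
  "cst (a - b) = cst a - cst b" "cst 0 = 0" "cst 1 = 1"
  by (auto intro!: sfun_eqI simp: ev_nz_simps)

lemma cst_of_nat: "cst (of_nat n) = of_nat n"
  by (induction n) (auto simp: cst_simps)

lemma numeral_sfun: "(numeral n :: sfun) = cst (numeral n)"
  by (metis cst_of_nat of_nat_numeral)

lemma ev_numeral [simp]: "x \<noteq> 0 \<Longrightarrow> ev (numeral n) x = numeral n"
  by (simp add: numeral_sfun ev_nz_simps)

lemma ev_sum [simp]: "ev (sum f I) x = (\<Sum>i\<in>I. ev (f i) x)"
  by (induction I rule: infinite_finite_induct) auto

lemma ev_has_derivative:
  assumes "x \<noteq> 0"
  shows "(ev a has_derivative (\<lambda>v. \<Sum>i\<in>UNIV. v $ i * ev (D i a) x)) (at x)"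
proof -
  have d: "(ev a has_derivative frechet_derivative (ev a) (at x)) (at x)"
    using assms by (intro smooth_on_has_derivative[OF ev_smooth]) auto
  then have "frechet_derivative (ev a) (at x) v = (\<Sum>i\<in>UNIV. v $ i * ev (D i a) x)" for v
  proof -
    have "ev a differentiable (at x)" using d unfolding differentiable_def by blast
    from frechet_derivative_partial[OF this, of v] show ?thesis
      using assms by (simp only: D.rep_eq if_False)
  qed
  then have "frechet_derivative (ev a) (at x) = (\<lambda>v. \<Sum>i\<in>UNIV. v $ i * ev (D i a) x)" by (rule ext)
  then show ?thesis using d by simp
qed

lemma D_eqI:
  assumes "\<And>x. x \<noteq> 0 \<Longrightarrow> (ev a has_derivative f' x) (at x)"
    and "\<And>x. x \<noteq> 0 \<Longrightarrow> f' x (axis i 1) = ev b x"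
  shows "D i a = b"
proof (rule sfun_eqI)
  fix x :: "real^3" assume "x \<noteq> 0"
  then show "ev (D i a) x = ev b x"
    using partial_unique[OF assms(1)] assms(2) by (simp add: D.rep_eq)
qed

lemma sum_axis [simp]: "(\<Sum>i\<in>UNIV. axis k (1::real) $ i * f i) = f (k::3)"
proof -
  have "(\<Sum>i\<in>UNIV. axis k (1::real) $ i * f i) = (\<Sum>i\<in>UNIV. if i = k then f i else 0)"
    by (rule sum.cong) (auto simp: axis_def)
  then show ?thesis by simp
qed

lemma has_derivative_cong_punctured:
  fixes f g :: "real^3 \<Rightarrow> real"
  assumes "(f has_derivative f') (at x)" "x \<noteq> 0" "\<And>y. y \<noteq> 0 \<Longrightarrow> g y = f y"
  shows "(g has_derivative f') (at x)"
  using has_derivative_transform_within_open[OF assms(1) open_punctured] assms(2,3) by auto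

lemma D_add [simp]: "D i (a + b) = D i a + D i b"
  by (rule D_eqI, rule has_derivative_cong_punctured[OF has_derivative_add[OF ev_has_derivative ev_has_derivative]])
    auto

lemma D_mult [simp]: "D i (a * b) = D i a * b + a * D i b"
  by (rule D_eqI, rule has_derivative_cong_punctured[OF has_derivative_mult[OF ev_has_derivative ev_has_derivative]])
    auto

lemma D_cst [simp]: "D i (cst c) = 0"
  by (rule D_eqI, rule has_derivative_cong_punctured[OF has_derivative_const])
    (auto simp: ev_nz_simps)

lemma D_0 [simp]: "D i 0 = 0" and D_1 [simp]: "D i 1 = 0" and D_numeral [simp]: "D i (numeral n) = 0"
  using D_cst[of i 0] D_cst[of i 1] by (simp_all add: cst_simps(5,6) numeral_sfun)

lemma D_minus [simp]: "D i (- a) = - D i a"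
  using D_add[of i a "- a"] by (simp del: D_add add: eq_neg_iff_add_eq_0 add.commute)

lemma D_diff [simp]: "D i (a - b) = D i a - D i b"
  using D_add[of i a "- b"] by (simp del: D_add)

lemma D_sum [simp]: "D i (sum f I) = (\<Sum>j\<in>I. D i (f j))"
  by (induction I rule: infinite_finite_induct) auto

lemma D_X: "D i (X j) = (if i = j then 1 else 0)"
  by (rule D_eqI, rule has_derivative_cong_punctured[OF bounded_linear_imp_has_derivative[OF bounded_linear_vec_nth[of j]]])
    (auto simp: axis_def ev_nz_simps)

lemma D_commute: "D i (D j a) = D j (D i a)"
proof (rule sfun_eqI)
  have *: "ev (D i (D j a)) x = partial i (partial j (ev a)) x" if "x \<noteq> 0" for i j x
  proof -
    have "(partial j (ev a) has_derivative frechet_derivative (partial j (ev a)) (at x)) (at x)"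
      using that by (intro smooth_on_has_derivative[OF smooth_on_partial[OF ev_smooth]]) auto
    then have "(ev (D j a) has_derivative frechet_derivative (partial j (ev a)) (at x)) (at x)"
      by (rule has_derivative_cong_punctured) (auto simp: that D.rep_eq)
    then show ?thesis using that by (simp add: D.rep_eq[of i] partial_unique) (simp add: partial_def)
  qed
  fix x :: "real^3" assume "x \<noteq> 0"
  then show "ev (D i (D j a)) x = ev (D j (D i a)) x"
    by (simp add: * partial_commute[OF ev_smooth])
qed

lemma rad_mult_D_rad: "rad * D i rad = X i"
proof -
  have "D i rad = X i * invf rad"
  proof (rule D_eqI)
    fix x :: "real^3" assume "x \<noteq> 0"
    show "(ev rad has_derivative (\<lambda>v. v \<bullet> sgn x)) (at x)"
      by (rule has_derivative_cong_punctured[OF has_derivative_norm]) (use \<open>x \<noteq> 0\<close> in auto)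
    show "axis i 1 \<bullet> sgn x = ev (X i * invf rad) x"
      using \<open>x \<noteq> 0\<close> by (simp add: inner_axis' sgn_div_norm invf.rep_eq)
  qed
  moreover have "rad * invf rad = 1"
    by (rule sfun_eqI) (auto simp: ev_nz_simps invf.rep_eq)
  ultimately show ?thesis by (metis mult.left_commute mult.right_neutral)
qed

lemma mult_invf: "(\<And>x. x \<noteq> 0 \<Longrightarrow> ev a x \<noteq> 0) \<Longrightarrow> a * invf a = 1"
  by (rule sfun_eqI) (auto simp: ev_nz_simps invf.rep_eq)

text \<open>Differentiate \<open>a * b = 1\<close> and multiply by \<open>b\<close>: the quotient
  rule without any division.\<close>

lemma D_inverse:
  assumes "a * b = 1"
  shows "D i b = - (b * b * D i a)"
proof -
  have "b * (D i a * b + a * D i b) = 0"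
    using arg_cong[OF assms, of "D i"] by simp
  moreover have "b * (D i a * b + a * D i b) = b * b * D i a + (a * b) * D i b"
    by (simp add: algebra_simps)
  ultimately show ?thesis using assms by (simp add: eq_neg_iff_add_eq_0 add.commute)
qed

lemma D_expf [simp]: "D i (expf a) = expf a * D i a"
  by (rule D_eqI, rule has_derivative_cong_punctured[OF has_derivative_exp[OF ev_has_derivative]])
    (auto simp: ev_nz_simps)

lemma expf_minus: "expf a * expf (- a) = 1"
  by (rule sfun_eqI) (auto simp: ev_nz_simps simp flip: exp_add)

lemma expf_add: "expf (a + b) = expf a * expf b"
  by (rule sfun_eqI) (auto simp: ev_nz_simps exp_add)

section \<open>Radial functions, the Euler operator and the Laplacian\<close>

definition rinv :: sfun where "rinv = invf rad"

lemma rad_rinv: "rad * rinv = 1"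
  unfolding rinv_def by (rule mult_invf) auto

lemma rad_square: "rad * rad = (\<Sum>i\<in>UNIV. X i * X i)"
proof (rule sfun_eqI)
  fix x :: "real^3"
  show "ev (rad * rad) x = ev (\<Sum>i\<in>UNIV. X i * X i) x"
    using dot_square_norm[of x] by (simp add: power2_eq_square inner_vec_def)
qed

lemma D_rad: "D i rad = X i * rinv"
proof -
  have "D i rad = (rad * rinv) * D i rad" by (simp add: rad_rinv)
  also have "\<dots> = rinv * (rad * D i rad)" by (simp add: mult_ac)
  finally show ?thesis by (simp add: rad_mult_D_rad mult_ac)
qed

lemma D_rinv: "D i rinv = - (X i * rinv * rinv * rinv)"
  by (simp add: D_inverse[OF rad_rinv] D_rad algebra_simps)

text \<open>By Euler's theorem, homogeneity of degree \<open>d\<close> is the equation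
  \<open>Euler a = d * a\<close>, which lives inside the ring and is inherited by sums, products and
  derivatives by plain algebra.\<close>

definition Euler :: "sfun \<Rightarrow> sfun" where
  "Euler a = (\<Sum>j\<in>UNIV. X j * D j a)"

definition Lap :: "sfun \<Rightarrow> sfun" where
  "Lap a = (\<Sum>j\<in>UNIV. D j (D j a))"

lemma Euler_homogeneous_0:
  assumes "Euler a = 0" "t > 0" "x \<noteq> 0"
  shows "ev a (t *\<^sub>R x) = ev a x"
proof -
  have d: "((\<lambda>s. ev a (s *\<^sub>R x)) has_real_derivative 0) (at s)" if "s > 0" for s
  proof -
    have "((\<lambda>s. ev a (s *\<^sub>R x)) has_derivative
      (\<lambda>h. \<Sum>i\<in>UNIV. (h *\<^sub>R x) $ i * ev (D i a) (s *\<^sub>R x))) (at s)"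
      by (rule has_derivative_compose[of "\<lambda>s. s *\<^sub>R x" _ _ UNIV "ev a"])
        (use that assms in \<open>auto intro!: derivative_eq_intros ev_has_derivative\<close>)
    moreover have "(\<Sum>i\<in>UNIV. (h *\<^sub>R x) $ i * ev (D i a) (s *\<^sub>R x)) = 0" for h
    proof -
      have "s * (\<Sum>i\<in>UNIV. (h *\<^sub>R x) $ i * ev (D i a) (s *\<^sub>R x)) = h * ev (Euler a) (s *\<^sub>R x)"
        by (simp add: Euler_def sum_distrib_left mult_ac)
      then show ?thesis using assms that by simp
    qed
    ultimately show ?thesis
      by (simp only: has_field_derivative_def) (simp add: lambda_zero)
  qed
  have "\<exists>c. \<forall>s\<in>{0<..}. ev a (s *\<^sub>R x) = c"
    by (rule has_field_derivative_zero_constant) (auto intro: DERIV_subset d)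
  then show ?thesis using assms(2)
    by (metis greaterThan_iff scaleR_one zero_less_one)
qed

lemma const_if_D_zero:
  assumes "\<And>i. D i a = 0"
  shows "\<exists>c. a = cst c"
proof -
  have "ev a constant_on (- {0})"
  proof (rule has_derivative_zero_connected_constant_on[of _ "{}"])
    show "connected (- {0::real^3})" by (simp add: connected_punctured_universe)
    show "\<forall>x\<in>- {0} - {}. (ev a has_derivative (\<lambda>h. 0)) (at x within - {0})"
      using ev_has_derivative[of _ a] assms by (auto intro: has_derivative_at_withinI)
  qed (auto intro: smooth_on_imp_continuous_on ev_smooth)
  then obtain c where "\<And>x. x \<noteq> 0 \<Longrightarrow> ev a x = c" by (auto simp: constant_on_def)
  then show ?thesis by (metis ev_nz_simps(2) sfun_eqI)
qed

lemma Euler_simps [simp]: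
  "Euler (a + b) = Euler a + Euler b" "Euler (a - b) = Euler a - Euler b" "Euler (- a) = - Euler a"
  "Euler (a * b) = Euler a * b + a * Euler b" "Euler (cst c) = 0" "Euler (expf a) = expf a * Euler a"
  "Euler (X i) = X i" "Euler 0 = 0" "Euler 1 = 0" "Euler (numeral n) = 0"
  by (simp_all add: Euler_def sum_3 algebra_simps D_X forall_3) (use exhaust_3[of i] in auto)

lemma Euler_rad [simp]: "Euler rad = rad"
proof -
  have "Euler rad = (\<Sum>i\<in>UNIV. X i * X i) * rinv"
    by (simp add: Euler_def D_rad sum_distrib_right mult.assoc)
  then show ?thesis by (metis rad_square mult.assoc rad_rinv mult.right_neutral)
qed

lemma Euler_inverse: "a * b = 1 \<Longrightarrow> Euler b = - (b * b * Euler a)"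
  by (simp add: Euler_def D_inverse[of a b] sum_negf sum_distrib_left mult.left_commute)

lemma Euler_inverse_degree_1:
  assumes "a * b = 1" "Euler a = a"
  shows "Euler b = - b"
proof -
  have "Euler b = - (b * (a * b))"
    using Euler_inverse[OF assms(1)] assms(2) by (simp add: mult_ac)
  then show ?thesis by (simp add: assms(1))
qed

lemma Euler_rinv [simp]: "Euler rinv = - rinv"
  by (rule Euler_inverse_degree_1[OF rad_rinv Euler_rad])

text \<open>Each derivative lowers the degree of homogeneity by one.\<close>

lemma Euler_D: "Euler (D i a) = D i (Euler a) - D i a"
  using exhaust_3[of i] by (auto simp: Euler_def sum_3 D_X D_commute algebra_simps)

lemma Lap_simps:
  "Lap (a + b) = Lap a + Lap b" "Lap (a - b) = Lap a - Lap b" "Lap (- a) = - Lap a"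
  "Lap (a * b) = Lap a * b + 2 * (\<Sum>i\<in>UNIV. D i a * D i b) + a * Lap b" "Lap (cst c) = 0"
  "Lap (X i) = 0" "Lap (expf a) = expf a * (Lap a + (\<Sum>i\<in>UNIV. D i a * D i a))"
  by (simp_all add: Lap_def sum_3 algebra_simps D_X)

section \<open>The strong maximum principle for homogeneous functions of degree zero\<close>

text \<open>On a coordinate line short enough to miss the origin, a positive second derivative would
  make the first derivative positive just to the right of the critical point, and the mean value
  theorem would produce a larger value.\<close>

lemma ev_local_max:
  assumes x: "x \<noteq> 0" and e: "e > 0" and m: "\<And>y. y \<in> ball x e \<Longrightarrow> ev a y \<le> ev a x"
  shows "ev (D i a) x = 0" "ev (D i (D i a)) x \<le> 0"
proof -
  define \<delta> where "\<delta> = min e (norm x)"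
  have \<delta>: "\<delta> > 0" "\<delta> \<le> e" "\<delta> \<le> norm x" using x e by (auto simp: \<delta>_def)
  let ?l = "\<lambda>t. x + t *\<^sub>R axis i (1::real)"
  have l: "?l t \<in> ball x e" "?l t \<noteq> 0" if "\<bar>t\<bar> < \<delta>" for t
  proof -
    have d: "dist x (?l t) = \<bar>t\<bar>" by (simp add: dist_norm)
    then show "?l t \<in> ball x e" using that \<delta> by simp
    show "?l t \<noteq> 0" using d that \<delta> by auto
  qed
  have d: "((\<lambda>t. ev c (?l t)) has_real_derivative ev (D i c) (?l t)) (at t)" if "\<bar>t\<bar> < \<delta>" for t c
    using smooth_on_line_derivative[OF ev_smooth, of x t i c] l[OF that] by (simp add: D.rep_eq)
  show z: "ev (D i a) x = 0"
    using DERIV_local_max[OF d[of 0 a] \<delta>(1)] l(1) m \<delta>(1) by auto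
  show "ev (D i (D i a)) x \<le> 0"
  proof (rule ccontr)
    assume "\<not> ?thesis"
    then have p: "0 < ev (D i (D i a)) (?l 0)" by simp
    obtain d' where d': "d' > 0" "\<And>h. h > 0 \<Longrightarrow> h < d' \<Longrightarrow> ev (D i a) (?l 0) < ev (D i a) (?l h)"
      using DERIV_pos_inc_right[OF d[of 0 "D i a"] p] \<delta>(1) by auto
    define h where "h = min d' \<delta> / 2"
    have h: "h > 0" "h < d'" "h < \<delta>" using d' \<delta> by (auto simp: h_def)
    obtain t where t: "0 < t" "t < h" "ev a (?l h) - ev a (?l 0) = (h - 0) * ev (D i a) (?l t)"
      using MVT2[OF h(1), of "\<lambda>t. ev a (?l t)" "\<lambda>t. ev (D i a) (?l t)"] d h by fastforce
    have "ev (D i a) (?l t) > 0" using d'(2)[of t] t h z by auto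
    then have "ev a (?l h) - ev a (?l 0) > 0" using t h by simp
    then have "ev a (?l h) > ev a x" by simp
    then show False using m[OF l(1)[of h]] h by auto
  qed
qed

definition lin :: "real^3 \<Rightarrow> sfun" where
  "lin c = (\<Sum>i\<in>UNIV. cst (c $ i) * X i)"

lemma ev_lin: "ev (lin c) x = c \<bullet> x"
  by (cases "x = 0") (auto simp: lin_def inner_vec_def ev_nz_simps)

lemma D_lin [simp]: "D i (lin c) = cst (c $ i)"
  using exhaust_3[of i] by (auto simp: lin_def D_X sum_3)

lemma Euler_lin [simp]: "Euler (lin c) = lin c"
  by (simp add: lin_def Euler_def sum_3 D_X algebra_simps)

lemma ev_continuous_on: "continuous_on (sphere 0 1) (ev a)"
  by (rule continuous_on_subset[OF smooth_on_imp_continuous_on[OF ev_smooth]]) auto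

lemma ev_rinv_sphere: "norm x = 1 \<Longrightarrow> ev rinv x = 1"
  using arg_cong[OF rad_rinv, of "\<lambda>a. ev a x"] by (cases "x = 0") (auto simp: ev_nz_simps)

text \<open>The height function of a stereographic projection from a point slightly outside the sphere:
  its critical points lie on the circle \<open>p \<bullet> x = 1 / s\<close>.\<close>

definition stereo :: "real \<Rightarrow> real^3 \<Rightarrow> real^3 \<Rightarrow> sfun" where
  "stereo s p b = lin b * invf (cst s * rad - lin p)"

lemma stereo_denominator:
  assumes "s > 1" "norm p = 1"
  shows "(cst s * rad - lin p) * invf (cst s * rad - lin p) = 1"
proof (rule mult_invf)
  fix x :: "real^3" assume x: "x \<noteq> 0"
  have "p \<bullet> x \<le> norm x" using norm_cauchy_schwarz[of p x] assms by simp
  also have "\<dots> < s * norm x" using x assms by simp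
  finally show "ev (cst s * rad - lin p) x \<noteq> 0" using x by (simp add: ev_lin ev_nz_simps)
qed

lemma Euler_stereo:
  assumes "s > 1" "norm p = 1"
  shows "Euler (stereo s p b) = 0"
proof -
  have "Euler (invf (cst s * rad - lin p)) = - invf (cst s * rad - lin p)"
    by (rule Euler_inverse_degree_1[OF stereo_denominator[OF assms]]) simp
  then show ?thesis by (simp add: stereo_def)
qed

text \<open>With \<open>d = s - p \<bullet> x\<close> and \<open>\<beta> = b \<bullet> x\<close> the
  squared gradient is \<open>(d\<^sup>2 - \<beta>\<^sup>2 * (s\<^sup>2 - 1)) / d ^ 4\<close>.
  Bessel's inequality for \<open>p\<close> and \<open>b\<close> bounds
  \<open>\<beta>\<^sup>2\<close> by \<open>1 - (p \<bullet> x)\<^sup>2\<close>, and the numerator is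
  then at least the square of \<open>1 - s * (p \<bullet> x)\<close>.\<close>

lemma stereo_gradient:
  assumes s: "s > 1" and p: "norm p = 1" and b: "norm b = 1" "b \<bullet> p = 0" and x: "norm x = 1" "s * (p \<bullet> x) < 1"
  shows "(\<Sum>i\<in>UNIV. (ev (D i (stereo s p b)) x)\<^sup>2) > 0"
proof -
  define \<alpha> \<beta> d where "\<alpha> = p \<bullet> x" "\<beta> = b \<bullet> x" "d = s - \<alpha>"
  let ?I = "invf (cst s * rad - lin p)"
  have x0: "x \<noteq> 0" using x by auto
  have "\<alpha> \<le> 1" using norm_cauchy_schwarz[of p x] p x by (simp add: \<alpha>_\<beta>_d_def)
  then have d: "d > 0" using s by (simp add: \<alpha>_\<beta>_d_def)
  have I: "ev ?I x = 1 / d"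
    using arg_cong[OF stereo_denominator[OF s p], of "\<lambda>a. ev a x"] x0 d x
    by (simp add: ev_nz_simps ev_lin \<alpha>_\<beta>_d_def field_simps)
  have "ev (D i (stereo s p b)) x = (b $ i * d - \<beta> * (s * x $ i - p $ i)) / d\<^sup>2" for i
    using x0 x d
    by (simp add: stereo_def D_inverse[OF stereo_denominator[OF s p]] D_rad I ev_lin ev_nz_simps
        ev_rinv_sphere flip: \<alpha>_\<beta>_d_def) (simp add: field_simps power2_eq_square)
  then have "(\<Sum>i\<in>UNIV. (ev (D i (stereo s p b)) x)\<^sup>2)
      = (\<Sum>i\<in>UNIV. (b $ i * d - \<beta> * (s * x $ i - p $ i))\<^sup>2) / d ^ 4"
    by (simp add: power_divide sum_divide_distrib)
  also have "(\<Sum>i\<in>UNIV. (b $ i * d - \<beta> * (s * x $ i - p $ i))\<^sup>2)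
      = (norm (d *\<^sub>R b - \<beta> *\<^sub>R (s *\<^sub>R x - p)))\<^sup>2"
    unfolding power2_norm_eq_inner inner_vec_def by (simp add: power2_eq_square mult.commute)
  also have "\<dots> = d\<^sup>2 + \<beta>\<^sup>2 * (1 - s\<^sup>2)"
  proof -
    have "b \<bullet> b = 1" "p \<bullet> p = 1" "x \<bullet> x = 1" "b \<bullet> p = 0" "p \<bullet> b = 0" "b \<bullet> x = \<beta>" "x \<bullet> b = \<beta>"
      "p \<bullet> x = s - d" "x \<bullet> p = s - d"
      using p b x by (simp_all add: norm_eq_1 \<alpha>_\<beta>_d_def inner_commute)
    then show ?thesis
      unfolding power2_norm_eq_inner
      by (simp only: inner_simps power2_eq_square) (simp add: algebra_simps)
  qed
  finally have eq: "(\<Sum>i\<in>UNIV. (ev (D i (stereo s p b)) x)\<^sup>2) = (d\<^sup>2 + \<beta>\<^sup>2 * (1 - s\<^sup>2)) / d ^ 4" .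
  have "d\<^sup>2 + \<beta>\<^sup>2 * (1 - s\<^sup>2) > 0"
  proof -
    have "0 \<le> (x - \<alpha> *\<^sub>R p - \<beta> *\<^sub>R b) \<bullet> (x - \<alpha> *\<^sub>R p - \<beta> *\<^sub>R b)" by simp
    also have "\<dots> = 1 - \<alpha>\<^sup>2 - \<beta>\<^sup>2"
    proof -
      have "b \<bullet> b = 1" "p \<bullet> p = 1" "x \<bullet> x = 1" "b \<bullet> p = 0" "p \<bullet> b = 0" "b \<bullet> x = \<beta>" "x \<bullet> b = \<beta>"
        "p \<bullet> x = \<alpha>" "x \<bullet> p = \<alpha>"
        using p b x by (simp_all add: norm_eq_1 \<alpha>_\<beta>_d_def inner_commute)
      then show ?thesis
        by (simp only: inner_simps power2_eq_square) (simp add: algebra_simps)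
    qed
    finally have "\<beta>\<^sup>2 \<le> 1 - \<alpha>\<^sup>2" by simp
    then have "\<beta>\<^sup>2 * (s\<^sup>2 - 1) \<le> (1 - \<alpha>\<^sup>2) * (s\<^sup>2 - 1)"
      using s by (intro mult_right_mono) (simp_all add: one_le_power)
    moreover have "d\<^sup>2 - (1 - \<alpha>\<^sup>2) * (s\<^sup>2 - 1) = (1 - s * \<alpha>)\<^sup>2"
      by (simp add: \<alpha>_\<beta>_d_def power2_eq_square algebra_simps)
    moreover have "(1 - s * \<alpha>)\<^sup>2 > 0" using x(2) by (simp add: \<alpha>_\<beta>_d_def)
    moreover have "\<beta>\<^sup>2 * (1 - s\<^sup>2) = - (\<beta>\<^sup>2 * (s\<^sup>2 - 1))" by (simp add: algebra_simps)
    ultimately show ?thesis by linarith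
  qed
  then show ?thesis using d by (simp add: eq)
qed

text \<open>For \<open>H = exp (l * Y)\<close> the operator gives
  \<open>l * H * (l * G + W)\<close>, where \<open>G\<close> is the squared gradient of
  \<open>Y\<close> and \<open>W\<close> the operator applied to \<open>Y\<close>. Off the cap
  \<open>G\<close> is bounded below by compactness, so a large \<open>l\<close> beats
  \<open>W\<close> whatever the drift \<open>v\<close> is.\<close>

lemma ex_subsolution:
  fixes v :: "3 \<Rightarrow> sfun"
  assumes p: "norm p = 1" and \<eta>: "0 < \<eta>" "\<eta> \<le> 1"
  obtains H where "Euler H = 0" "\<And>x. x \<noteq> 0 \<Longrightarrow> ev H x > 0"
    "\<And>x. norm x = 1 \<Longrightarrow> p \<bullet> x \<le> 1 - \<eta> \<Longrightarrow> ev (Lap H + (\<Sum>i\<in>UNIV. v i * D i H)) x > 0"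
proof -
  \<comment> \<open>Then \<open>s * (1 - \<eta>) < 1\<close>, so the circle of critical points
    \<open>p \<bullet> x = 1 / s\<close> lies in the excluded cap, while \<open>s > 1\<close> keeps
    the denominator of \<open>stereo\<close> away from zero.\<close>
  define s where "s = 1 + \<eta> / 2"
  have s: "s > 1" using \<eta> by (simp add: s_def)
  obtain b where b: "norm b = 1" "b \<bullet> p = 0"
  proof -
    obtain y where y: "y \<noteq> 0" "orthogonal p y"
      using orthogonal_to_vector_exists[of p] by auto
    then show ?thesis
      using that[of "y /\<^sub>R norm y"] by (simp add: orthogonal_def inner_commute)
  qed
  define Y where "Y = stereo s p b"
  define K where "K = sphere 0 1 \<inter> {x. p \<bullet> x \<le> 1 - \<eta>}"
  have K: "compact K" unfolding K_def
    by (intro compact_Int_closed closed_Collect_le continuous_intros) auto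
  define G where "G = (\<Sum>i\<in>UNIV. D i Y * D i Y)"
  define W where "W = Lap Y + (\<Sum>i\<in>UNIV. v i * D i Y)"
  have G: "ev G x > 0" if "x \<in> K" for x
  proof -
    have "s * (p \<bullet> x) \<le> s * (1 - \<eta>)" using that s by (auto simp: K_def)
    also have "\<dots> < 1" using \<eta> by (simp add: s_def algebra_simps add_pos_pos)
    finally show ?thesis
      using stereo_gradient[OF s p b, of x] that
      by (simp add: G_def Y_def K_def power2_eq_square)
  qed
  obtain \<mu> where \<mu>: "\<mu> > 0" "\<And>x. x \<in> K \<Longrightarrow> \<mu> \<le> ev G x"
  proof (cases "K = {}")
    case False
    have "continuous_on K (ev G)" by (rule continuous_on_subset[OF ev_continuous_on]) (auto simp: K_def)
    from continuous_attains_inf[OF K False this] show ?thesis using G that by metis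
  qed (use that[of 1] in auto)
  obtain C where C: "\<And>x. x \<in> sphere 0 1 \<Longrightarrow> \<bar>ev W x\<bar> \<le> C" "C > 0"
    using compact_imp_bounded[OF compact_continuous_image[OF ev_continuous_on compact_sphere, of W]]
    by (force simp: bounded_pos)
  define l where "l = C / \<mu> + 1"
  have l: "l > 0" "l * \<mu> > C" using C \<mu> by (auto simp: l_def field_simps add_pos_pos)
  define H where "H = expf (cst l * Y)"
  have L: "Lap H + (\<Sum>i\<in>UNIV. v i * D i H) = H * (cst l * (cst l * G + W))"
    by (simp add: H_def Lap_simps G_def W_def sum_3 algebra_simps)
  show ?thesis
  proof
    show "Euler H = 0" by (simp add: H_def Y_def Euler_stereo[OF s p])
    show "ev H x > 0" if "x \<noteq> 0" for x using that by (simp add: H_def ev_nz_simps)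
    fix x :: "real^3" assume x: "norm x = 1" "p \<bullet> x \<le> 1 - \<eta>"
    then have xK: "x \<in> K" "x \<noteq> 0" by (auto simp: K_def)
    have "l * \<mu> \<le> l * ev G x" using \<mu>(2)[OF xK(1)] l by simp
    moreover have "\<bar>ev W x\<bar> \<le> C" using C(1)[of x] x by simp
    ultimately have "l * ev G x + ev W x > 0" using l(2) by linarith
    then show "ev (Lap H + (\<Sum>i\<in>UNIV. v i * D i H)) x > 0"
      unfolding L using xK l by (simp add: ev_nz_simps H_def)
  qed
qed

text \<open>A strict subsolution off a cap around \<open>p\<close>, added with a small factor, forces the maximum into
  the cap. As \<open>p\<close> is arbitrary, the maximum is attained everywhere; no Hopf lemma is needed.\<close>

theorem strong_max_principle:
  fixes v :: "3 \<Rightarrow> sfun"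
  assumes E: "Euler a = 0"
    and sub: "\<And>x. norm x = 1 \<Longrightarrow> ev (Lap a + (\<Sum>i\<in>UNIV. v i * D i a)) x \<ge> 0"
  shows "\<exists>c. a = cst c"
proof -
  have ne: "sphere (0::real^3) 1 \<noteq> {}" by simp
  obtain m where m: "norm m = 1" "\<And>y. norm y = 1 \<Longrightarrow> ev a y \<le> ev a m"
    using continuous_attains_sup[OF compact_sphere ne ev_continuous_on, of a] by auto
  have "ev a p = ev a m" if p: "norm p = 1" for p
  proof (rule ccontr)
    assume "ev a p \<noteq> ev a m"
    then have lt: "ev a p < ev a m" using m(2)[OF p] by simp
    define M where "M = (ev a p + ev a m) / 2"
    have M: "ev a p < M" "M < ev a m" using lt by (auto simp: M_def)
    obtain \<delta> where \<delta>: "\<delta> > 0" "\<And>y. norm y = 1 \<Longrightarrow> dist y p < \<delta> \<Longrightarrow> ev a y < M"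
    proof -
      have "\<exists>d>0. \<forall>y\<in>sphere 0 1. dist y p < d \<longrightarrow> dist (ev a y) (ev a p) < M - ev a p"
        using ev_continuous_on[of a] p M unfolding continuous_on_iff by fastforce
      then show ?thesis using that by (force simp: dist_real_def)
    qed
    \<comment> \<open>Unit vectors satisfy
      \<open>(dist y p)\<^sup>2 = 2 - 2 * (p \<bullet> y)\<close>, so the cap
      \<open>p \<bullet> y > 1 - \<eta>\<close> lies within distance \<open>\<delta>\<close> of
      \<open>p\<close>.\<close>
    define \<eta> where "\<eta> = min (\<delta>\<^sup>2 / 2) 1"
    have \<eta>: "0 < \<eta>" "\<eta> \<le> 1" "2 * \<eta> \<le> \<delta>\<^sup>2" using \<delta>(1) by (auto simp: \<eta>_def)
    have cap: "ev a y < M" if "norm y = 1" "p \<bullet> y > 1 - \<eta>" for y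
    proof -
      have "(dist y p)\<^sup>2 = y \<bullet> y + p \<bullet> p - 2 * (p \<bullet> y)"
        by (simp add: dist_norm power2_norm_eq_inner inner_simps inner_commute)
      also have "\<dots> = 2 - 2 * (p \<bullet> y)" using that p by (simp add: norm_eq_1)
      also have "\<dots> < \<delta>\<^sup>2" using that \<eta> by simp
      finally show ?thesis using \<delta> that by (simp add: power_less_imp_less_base)
    qed
    obtain H where H: "Euler H = 0" "\<And>x. x \<noteq> 0 \<Longrightarrow> ev H x > 0"
      "\<And>x. norm x = 1 \<Longrightarrow> p \<bullet> x \<le> 1 - \<eta> \<Longrightarrow> ev (Lap H + (\<Sum>i\<in>UNIV. v i * D i H)) x > 0"
      using ex_subsolution[OF p \<eta>(1,2), of v] by metis
    obtain C where C: "\<And>x. x \<in> sphere 0 1 \<Longrightarrow> \<bar>ev H x\<bar> \<le> C" "C > 0"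
      using compact_imp_bounded[OF compact_continuous_image[OF ev_continuous_on compact_sphere, of H]]
      by (force simp: bounded_pos)
    \<comment> \<open>In the cap the perturbed function stays below
      \<open>M + \<epsilon> * C\<close>, which is exactly the old maximum \<open>ev a m\<close>; at
      \<open>m\<close> it exceeds \<open>ev a m\<close> because \<open>H\<close> is positive. Its
      maximum is thus outside the cap.\<close>
    define \<epsilon> where "\<epsilon> = (ev a m - M) / C"
    have \<epsilon>: "\<epsilon> > 0" "M + \<epsilon> * C = ev a m" using M C by (auto simp: \<epsilon>_def)
    define A where "A = a + cst \<epsilon> * H"
    have evA: "ev A x = ev a x + \<epsilon> * ev H x" if "x \<noteq> 0" for x
      using that by (simp add: A_def ev_nz_simps)
    obtain n where n: "norm n = 1" "\<And>y. norm y = 1 \<Longrightarrow> ev A y \<le> ev A n"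
      using continuous_attains_sup[OF compact_sphere ne ev_continuous_on, of A] by auto
    have n0: "n \<noteq> 0" "m \<noteq> 0" using n m by auto
    have nK: "p \<bullet> n \<le> 1 - \<eta>"
    proof (rule ccontr)
      assume "\<not> ?thesis"
      then have "ev a n < M" using cap n by simp
      moreover have "\<epsilon> * ev H n \<le> \<epsilon> * C" using C(1)[of n] n \<epsilon> by simp
      moreover have "ev A m > ev a m" using evA n0 H(2) \<epsilon> by simp
      ultimately show False using n(2)[OF m(1)] evA[OF n0(1)] \<epsilon> by linarith
    qed
    have EA: "Euler A = 0" by (simp add: A_def E H)
    \<comment> \<open>Degree \<open>0\<close> turns a maximum over the sphere into a maximum over a
      ball in space, so the free second derivative test applies. The radius \<open>1\<close> keeps
      the ball off the origin.\<close>
    have max: "ev A y \<le> ev A n" if "y \<in> ball n 1" for y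
    proof -
      have y: "y \<noteq> 0" using that n by auto
      then have "ev A y = ev A (inverse (norm y) *\<^sub>R y)"
        using Euler_homogeneous_0[OF EA, of "inverse (norm y)" y] by simp
      then show ?thesis using n(2)[of "inverse (norm y) *\<^sub>R y"] y by simp
    qed
    have "ev (Lap A + (\<Sum>i\<in>UNIV. v i * D i A)) n \<le> 0"
      using ev_local_max[OF n0(1) zero_less_one max] by (simp add: Lap_def sum_nonpos)
    moreover have "ev (Lap A + (\<Sum>i\<in>UNIV. v i * D i A)) n
        = ev (Lap a + (\<Sum>i\<in>UNIV. v i * D i a)) n + \<epsilon> * ev (Lap H + (\<Sum>i\<in>UNIV. v i * D i H)) n"
      using n0 by (simp add: A_def Lap_simps sum_3 ev_nz_simps algebra_simps)
    ultimately show False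
      using sub[OF n(1)] mult_pos_pos[OF \<epsilon>(1) H(3)[OF n(1) nK]] by linarith
  qed
  then have "a = cst (ev a m)"
  proof (intro sfun_eqI)
    fix x :: "real^3" assume x: "x \<noteq> 0" and c: "\<And>p. norm p = 1 \<Longrightarrow> ev a p = ev a m"
    have "ev a x = ev a (inverse (norm x) *\<^sub>R x)"
      using Euler_homogeneous_0[OF E, of "inverse (norm x)" x] x by simp
    then show "ev a x = ev (cst (ev a m)) x" using c x by (simp add: ev_nz_simps)
  qed
  then show ?thesis by blast
qed

section \<open>Curl-free fields on the punctured space are gradients\<close>

lemma sum_mult_transpose:
  fixes w h a :: "3 \<Rightarrow> real"
  shows "(\<Sum>i\<in>UNIV. w i * (\<Sum>j\<in>UNIV. (t * h j) * A j i) + h i * a i)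
    = (\<Sum>j\<in>UNIV. h j * (a j + (\<Sum>i\<in>UNIV. w i * (t * A j i))))"
  by (simp add: sum_3 algebra_simps)

text \<open>The potential is the line integral of \<open>V\<close> along the segment from
  \<open>p\<close> to \<open>x\<close>, differentiated under the integral sign.\<close>

lemma star_potential:
  fixes V :: "3 \<Rightarrow> sfun"
  assumes curl: "\<And>i j. D i (V j) = D j (V i)"
    and S: "open S" "0 \<notin> S" "\<And>x. x \<in> S \<Longrightarrow> closed_segment p x \<subseteq> S"
  shows "\<exists>f. \<forall>x\<in>S. (f has_derivative (\<lambda>h. \<Sum>i\<in>UNIV. h $ i * ev (V i) x)) (at x)"
proof (intro exI ballI)
  let ?y = "\<lambda>x t. p + t *\<^sub>R (x - p)"
  define f where "f x t = (\<Sum>i\<in>UNIV. (x - p) $ i * ev (V i) (?y x t))" for x and t :: real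
  define c where "c j x t = ev (V j) (?y x t) + (\<Sum>i\<in>UNIV. (x - p) $ i * (t * ev (D j (V i)) (?y x t)))"
    for j x and t :: real
  define fx where "fx x t = (\<Sum>j\<in>UNIV. c j x t *\<^sub>R blinfun_inner_left (axis j (1::real)))" for x t
  have fx: "blinfun_apply (fx x t) h = (\<Sum>j\<in>UNIV. h $ j * c j x t)" for x t h
    by (simp add: fx_def blinfun.sum_left blinfun.scaleR_left inner_axis mult.commute)
  fix x0 assume x0: "x0 \<in> S"
  obtain e where e: "e > 0" "ball x0 e \<subseteq> S" using S(1) x0 open_contains_ball by metis
  have yS: "?y x t \<in> S" "?y x t \<noteq> 0" if "x \<in> S" "t \<in> cbox 0 1" for x t
  proof -
    have "?y x t \<in> closed_segment p x"
      using that by (auto simp: closed_segment_def algebra_simps intro!: exI[of _ t])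
    then show "?y x t \<in> S" using S(3) that by blast
    then show "?y x t \<noteq> 0" using S(2) by metis
  qed
  have cont: "continuous_on (ball x0 e \<times> cbox 0 1) (\<lambda>z. ev a (p + snd z *\<^sub>R (fst z - p)))" for a
    by (rule continuous_on_compose2[OF smooth_on_imp_continuous_on[OF ev_smooth]])
      (use yS e in \<open>auto intro!: continuous_intros\<close>)
  have cont1: "continuous_on (cbox 0 1) (\<lambda>t. ev a (?y x t))" if "x \<in> S" for a x
    by (rule continuous_on_compose2[OF smooth_on_imp_continuous_on[OF ev_smooth]])
      (use yS that in \<open>auto intro!: continuous_intros\<close>)
  have "((\<lambda>x. integral (cbox 0 1) (f x)) has_derivative blinfun_apply (integral (cbox 0 1) (fx x0)))
      (at x0 within ball x0 e)"
  proof (rule leibniz_rule)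
    fix x t assume x: "x \<in> ball x0 e" and t: "t \<in> cbox 0 (1::real)"
    have y: "?y x t \<noteq> 0" using yS(2) x t e by blast
    have "((\<lambda>x. f x t) has_derivative blinfun_apply (fx x t)) (at x)"
      unfolding f_def
    proof (rule has_derivative_eq_rhs)
      have "((\<lambda>x. ev a (?y x t)) has_derivative (\<lambda>h. \<Sum>i\<in>UNIV. (t *\<^sub>R h) $ i * ev (D i a) (?y x t))) (at x)" for a
        by (rule has_derivative_compose[of "\<lambda>x. ?y x t" _ _ UNIV "ev a"])
          (use y in \<open>auto intro!: derivative_eq_intros ev_has_derivative\<close>)
      moreover have "((\<lambda>x. (x - p) $ i) has_derivative (\<lambda>h. h $ i)) (at x)" for i
        by (auto intro!: derivative_eq_intros bounded_linear.has_derivative[OF bounded_linear_vec_nth])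
      ultimately show "((\<lambda>x. \<Sum>i\<in>UNIV. (x - p) $ i * ev (V i) (?y x t)) has_derivative
         (\<lambda>h. \<Sum>i\<in>UNIV. (x - p) $ i * (\<Sum>j\<in>UNIV. (t *\<^sub>R h) $ j * ev (D j (V i)) (?y x t))
            + h $ i * ev (V i) (?y x t))) (at x)"
        by (intro has_derivative_sum has_derivative_mult)
      show "(\<lambda>h. \<Sum>i\<in>UNIV. (x - p) $ i * (\<Sum>j\<in>UNIV. (t *\<^sub>R h) $ j * ev (D j (V i)) (?y x t))
            + h $ i * ev (V i) (?y x t)) = blinfun_apply (fx x t)"
        by (rule ext) (simp only: fx c_def vector_scaleR_component real_scaleR_def sum_mult_transpose)
    qed
    then show "((\<lambda>x. f x t) has_derivative blinfun_apply (fx x t)) (at x within ball x0 e)"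
      by (rule has_derivative_at_withinI)
  next
    fix x assume "x \<in> ball x0 e"
    then show "f x integrable_on cbox 0 1"
      unfolding f_def using e(2)
      by (intro integrable_continuous continuous_intros cont1) auto
  next
    show "continuous_on (ball x0 e \<times> cbox 0 1) (\<lambda>(x, t). fx x t)"
      unfolding fx_def c_def split_beta by (intro continuous_intros cont)
  qed (use e in auto)
  then have "((\<lambda>x. integral (cbox 0 1) (f x)) has_derivative blinfun_apply (integral (cbox 0 1) (fx x0))) (at x0)"
    using at_within_open[OF _ open_ball, of x0 x0 e] e(1) by (metis centre_in_ball)
  moreover have "blinfun_apply (integral (cbox 0 1) (fx x0)) h = (\<Sum>i\<in>UNIV. h $ i * ev (V i) x0)" for h
  proof -
    have "continuous_on (cbox 0 1) (fx x0)"
      unfolding fx_def c_def by (intro continuous_intros cont1 x0)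
    then have "integral (cbox 0 1) (\<lambda>t. blinfun_apply (fx x0 t) h) = blinfun_apply (integral (cbox 0 1) (fx x0)) h"
      by (metis blinfun_apply_integral integrable_continuous)
    \<comment> \<open>Curl-freeness makes the differentiated integrand the
      \<open>t\<close>-derivative of \<open>t\<close> times \<open>V\<close> at
      \<open>p + t *\<^sub>R (x0 - p)\<close>, paired with \<open>h\<close>. The factor
      \<open>t\<close> kills the lower end point.\<close>
    moreover have "((\<lambda>t. blinfun_apply (fx x0 t) h) has_integral
       (1 * (\<Sum>j\<in>UNIV. h $ j * ev (V j) (?y x0 1)) - 0 * (\<Sum>j\<in>UNIV. h $ j * ev (V j) (?y x0 0)))) {0..1}"
    proof (rule fundamental_theorem_of_calculus)
      fix t :: real assume t: "t \<in> {0..1}"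
      then have y: "?y x0 t \<noteq> 0" using yS(2)[OF x0, of t] by simp
      have "((\<lambda>t. ev a (?y x0 t)) has_derivative (\<lambda>s. \<Sum>i\<in>UNIV. (s *\<^sub>R (x0 - p)) $ i * ev (D i a) (?y x0 t))) (at t)" for a
        by (rule has_derivative_compose[of "\<lambda>t. ?y x0 t" _ _ UNIV "ev a"])
          (use y in \<open>auto intro!: derivative_eq_intros ev_has_derivative\<close>)
      then have "((\<lambda>t. ev a (?y x0 t)) has_real_derivative (\<Sum>i\<in>UNIV. (x0 - p) $ i * ev (D i a) (?y x0 t))) (at t)" for a
        unfolding has_field_derivative_def
        by (rule has_derivative_eq_rhs) (simp add: fun_eq_iff sum_distrib_left mult_ac)
      note d = this
      have "((\<lambda>t. t * (\<Sum>j\<in>UNIV. h $ j * ev (V j) (?y x0 t))) has_real_derivative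
         1 * (\<Sum>j\<in>UNIV. h $ j * ev (V j) (?y x0 t)) +
         (\<Sum>j\<in>UNIV. h $ j * (\<Sum>i\<in>UNIV. (x0 - p) $ i * ev (D i (V j)) (?y x0 t))) * t) (at t)"
        by (intro DERIV_mult DERIV_ident DERIV_sum DERIV_cmult d)
      moreover have "1 * (\<Sum>j\<in>UNIV. h $ j * ev (V j) (?y x0 t)) +
         (\<Sum>j\<in>UNIV. h $ j * (\<Sum>i\<in>UNIV. (x0 - p) $ i * ev (D i (V j)) (?y x0 t))) * t = blinfun_apply (fx x0 t) h"
        unfolding fx c_def
        by (simp add: sum.distrib distrib_left sum_distrib_right sum_distrib_left mult.assoc curl)
          (simp add: mult_ac)
      ultimately show "((\<lambda>t. t * (\<Sum>j\<in>UNIV. h $ j * ev (V j) (?y x0 t))) has_vector_derivative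
         blinfun_apply (fx x0 t) h) (at t within {0..1})"
        by (simp only: has_real_derivative_iff_has_vector_derivative has_vector_derivative_at_within)
    qed simp
    ultimately show ?thesis by (simp add: integral_unique)
  qed
  ultimately show "((\<lambda>x. integral (cbox 0 1) (f x)) has_derivative (\<lambda>h. \<Sum>i\<in>UNIV. h $ i * ev (V i) x0)) (at x0)"
    by (rule has_derivative_eq_rhs[OF _ ext])
qed

text \<open>The set is the product of a punctured plane, modelled on the complex numbers, and a
  line.\<close>

lemma connected_complement_axis: "connected {x::real^3. x $ 1 \<noteq> 0 \<or> x $ 2 \<noteq> 0}"
proof -
  let ?g = "\<lambda>(z::complex, t::real). Re z *\<^sub>R axis 1 1 + Im z *\<^sub>R axis 2 1 + t *\<^sub>R axis 3 1 :: real^3"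
  have "{x::real^3. x $ 1 \<noteq> 0 \<or> x $ 2 \<noteq> 0} = ?g ` ((- {0}) \<times> UNIV)"
  proof (intro equalityI subsetI)
    fix x :: "real^3" assume "x \<in> {x. x $ 1 \<noteq> 0 \<or> x $ 2 \<noteq> 0}"
    then have "(Complex (x $ 1) (x $ 2), x $ 3) \<in> (- {0}) \<times> UNIV" by (auto simp: complex_eq_iff)
    moreover have "x = ?g (Complex (x $ 1) (x $ 2), x $ 3)"
      by (simp add: vec_eq_iff forall_3 axis_def)
    ultimately show "x \<in> ?g ` ((- {0}) \<times> UNIV)" by blast
  qed (auto simp: axis_def complex_eq_iff)
  moreover have "connected (?g ` ((- {0}) \<times> UNIV))"
    by (intro connected_continuous_image connected_Times connected_punctured_universe)
      (auto simp: split_beta intro!: continuous_intros)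
  ultimately show ?thesis by simp
qed

text \<open>The punctured space is covered by the complements \<open>S 1\<close> and
  \<open>S (- 1)\<close> of two opposite closed half-axes, each star-shaped about a point of the
  other half-axis. Their intersection is connected, so the two potentials differ there by one
  constant and can be glued.\<close>

theorem curl_free_imp_gradient:
  fixes V :: "3 \<Rightarrow> sfun"
  assumes curl: "\<And>i j. D i (V j) = D j (V i)"
  shows "\<exists>f. \<forall>i. D i f = V i"
proof -
  let ?dV = "\<lambda>x h. \<Sum>i\<in>UNIV. h $ i * ev (V i) x"
  define S where "S \<sigma> = {x::real^3. x $ 1 \<noteq> 0 \<or> x $ 2 \<noteq> 0 \<or> \<sigma> * x $ 3 > 0}" for \<sigma> :: real
  let ?W = "{x::real^3. x $ 1 \<noteq> 0 \<or> x $ 2 \<noteq> 0}"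
  have oW: "open ?W"
    by (intro open_Collect_disj open_Collect_neq continuous_intros)
  have oS: "open (S \<sigma>)" for \<sigma>
    unfolding S_def
    by (intro open_Collect_disj open_Collect_neq open_Collect_less continuous_intros)
  have "\<exists>f. \<forall>x\<in>S \<sigma>. (f has_derivative ?dV x) (at x)" if "\<bar>\<sigma>\<bar> = 1" for \<sigma>
  proof (rule star_potential[OF curl oS, of _ "\<sigma> *\<^sub>R axis 3 1"])
    show "0 \<notin> S \<sigma>" by (simp add: S_def)
    fix x assume x: "x \<in> S \<sigma>"
    have sq: "\<sigma> * \<sigma> = 1" using that by (metis abs_mult_self_eq mult_1)
    show "closed_segment (\<sigma> *\<^sub>R axis 3 1) x \<subseteq> S \<sigma>"
    proof
      fix y assume "y \<in> closed_segment (\<sigma> *\<^sub>R axis 3 1) x"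
      then obtain t where t: "0 \<le> t" "t \<le> 1" and y: "y = (1 - t) *\<^sub>R (\<sigma> *\<^sub>R axis 3 1) + t *\<^sub>R x"
        by (auto simp: closed_segment_def)
      have y12: "y $ 1 = t * x $ 1" "y $ 2 = t * x $ 2" by (simp_all add: y axis_def)
      have "\<sigma> * y $ 3 = (1 - t) * (\<sigma> * \<sigma>) + t * (\<sigma> * x $ 3)" by (simp add: y axis_def algebra_simps)
      then have y3: "\<sigma> * y $ 3 = (1 - t) + t * (\<sigma> * x $ 3)" by (simp add: sq)
      show "y \<in> S \<sigma>"
      proof (cases "t = 0")
        case True
        then show ?thesis using y3 by (simp add: S_def)
      next
        case False
        then have "\<sigma> * x $ 3 > 0 \<Longrightarrow> \<sigma> * y $ 3 > 0" using t y3 by (simp add: add_nonneg_pos)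
        then show ?thesis using x False by (auto simp: S_def y12)
      qed
    qed
  qed
  note ex = this
  obtain f1 where f1: "\<forall>x\<in>S 1. (f1 has_derivative ?dV x) (at x)"
    using ex[of 1] by auto
  obtain f2 where f2: "\<forall>x\<in>S (- 1). (f2 has_derivative ?dV x) (at x)"
    using ex[of "- 1"] by auto
  note f = f1[rule_format] f2[rule_format]
  have W: "?W = S 1 \<inter> S (- 1)" by (auto simp: S_def)
  have dW: "((\<lambda>x. f1 x - f2 x) has_derivative (\<lambda>h. 0)) (at x)" if "x \<in> ?W" for x
  proof -
    have "x \<in> S 1" "x \<in> S (- 1)" using that W by auto
    from has_derivative_diff[OF f(1)[OF this(1)] f(2)[OF this(2)]] show ?thesis by simp
  qed
  have "(\<lambda>x. f1 x - f2 x) constant_on ?W"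
  proof (rule has_derivative_zero_connected_constant_on[OF connected_complement_axis oW finite.emptyI])
    show "continuous_on ?W (\<lambda>x. f1 x - f2 x)"
      using dW by (intro continuous_at_imp_continuous_on) (blast intro: has_derivative_continuous)
    show "\<forall>x\<in>?W - {}. ((\<lambda>x. f1 x - f2 x) has_derivative (\<lambda>h. 0)) (at x within ?W)"
      using dW by (auto intro: has_derivative_at_withinI)
  qed
  then obtain c where "\<forall>x\<in>?W. f1 x - f2 x = c"
    unfolding constant_on_def by blast
  then have c: "f1 x = f2 x + c" if "x \<in> ?W" for x
    using that by (simp add: diff_eq_eq add.commute)
  \<comment> \<open>Outside \<open>S 1\<close> only the origin and the negative third half-axis
    remain, and the latter lies in \<open>S (- 1)\<close>. The value \<open>0\<close> at the origin
    is what the type \<open>sfun\<close> demands.\<close>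
  define f where "f x = (if x = 0 then 0 else if x \<in> S 1 then f1 x else f2 x + c)" for x
  have d: "(f has_derivative ?dV x) (at x)" if "x \<noteq> 0" for x
  proof (cases "x \<in> S 1")
    case True
    show ?thesis
      by (rule has_derivative_transform_within_open[OF f(1)[OF True] oS True])
        (auto simp: f_def S_def)
  next
    case False
    then have x: "x \<in> S (- 1)" using that
      by (auto simp: S_def vec_eq_iff forall_3 not_less less_le)
    have "((\<lambda>x. f2 x + c) has_derivative ?dV x) (at x)"
      using f(2)[OF x] by (auto intro!: derivative_eq_intros)
    then show ?thesis
    proof (rule has_derivative_transform_within_open[OF _ oS x])
      fix y assume y: "y \<in> S (- 1)"
      then have "y \<noteq> 0" by (auto simp: S_def)
      moreover have "f1 y = f2 y + c" if "y \<in> S 1" using c y that W by blast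
      ultimately show "f2 y + c = f y" by (simp add: f_def)
    qed
  qed
  have "smooth_on f (- {0})"
  proof (rule smooth_onI_derivative[OF open_punctured, of _ ?dV])
    fix v :: "real^3"
    have "smooth_on (ev (\<Sum>i\<in>UNIV. cst (v $ i) * V i)) (- {0})" by (rule ev_smooth)
    then show "smooth_on (\<lambda>x. ?dV x v) (- {0})"
      using smooth_on_cong[OF open_punctured, of "ev (\<Sum>i\<in>UNIV. cst (v $ i) * V i)" "\<lambda>x. ?dV x v"]
      by (simp add: ev_nz_simps)
  qed (use d in auto)
  then have ef: "ev (Abs_sfun f) = f" by (intro Abs_sfun_inverse) (simp add: f_def)
  have "D i (Abs_sfun f) = V i" for i
    by (rule D_eqI[of _ ?dV]) (use d in \<open>auto simp: ef\<close>)
  then show ?thesis by blast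
qed

section \<open>The Bernoulli function\<close>

lemma Euler_Lap: "Euler (Lap a) = Lap (Euler a) - 2 * Lap a"
  by (simp add: Lap_def Euler_D sum_subtractf sum_3 algebra_simps)

lemma D_Lap: "D i (Lap a) = Lap (D i a)"
  by (simp add: Lap_def sum_3 D_commute)

text \<open>The equation expresses the gradient of \<open>P\<close> by terms of degree
  \<open>-3\<close>; commuting \<open>Euler\<close> with \<open>D i\<close> changes
  \<open>-3\<close> to \<open>-2\<close>. So \<open>P\<close> has degree \<open>-2\<close> up to an
  additive constant.\<close>

lemma homogeneous_pressure:
  assumes "\<And>i. Euler (U i) = - U i"
    and "\<And>i. Lap (U i) = (\<Sum>j\<in>UNIV. U j * D j (U i)) + D i P"
  shows "D i (Euler P) = - (2 * D i P)"
proof -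
  have P: "D i P = Lap (U i) - (\<Sum>j\<in>UNIV. U j * D j (U i))" for i
    using assms(2)[of i] by simp
  have "Lap (- U i) = - Lap (U i)" by (rule Lap_simps)
  then have "Euler (D i P) = - (3 * D i P)"
    unfolding P by (simp add: Euler_Lap Euler_D assms(1) sum_3 algebra_simps)
  then show ?thesis by (simp add: Euler_D algebra_simps)
qed

text \<open>\<open>Euler P\<close> is exactly of degree \<open>-2\<close>, since the unknown
  additive constant of \<open>P\<close> is differentiated away. For this reason
  \<open>Euler P\<close> and not \<open>P\<close> enters the Bernoulli function.\<close>

lemma Euler_Euler_pressure:
  assumes "\<And>i. Euler (U i) = - U i"
    and "\<And>i. Lap (U i) = (\<Sum>j\<in>UNIV. U j * D j (U i)) + D i P"
  shows "Euler (Euler P) = - (2 * Euler P)"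
proof -
  have "Euler (Euler P) = (\<Sum>j\<in>UNIV. X j * D j (Euler P))" by (rule Euler_def)
  also have "\<dots> = (\<Sum>j\<in>UNIV. X j * - (2 * D j P))"
    by (simp only: homogeneous_pressure[OF assms])
  also have "\<dots> = - (2 * Euler P)" by (simp add: Euler_def sum_3 algebra_simps)
  finally show ?thesis .
qed

text \<open>The indices are of type \<open>3\<close>, so \<open>i + 1\<close> and \<open>i + 2\<close> are taken modulo \<open>3\<close>.\<close>

definition vcross :: "(3 \<Rightarrow> sfun) \<Rightarrow> (3 \<Rightarrow> sfun) \<Rightarrow> 3 \<Rightarrow> sfun" where
  "vcross a b i = a (i + 1) * b (i + 2) - a (i + 2) * b (i + 1)"

definition curl :: "(3 \<Rightarrow> sfun) \<Rightarrow> 3 \<Rightarrow> sfun" where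
  "curl a i = D (i + 1) (a (i + 2)) - D (i + 2) (a (i + 1))"

lemma index_mod_3: "(1::3) + 1 = 2" "(1::3) + 2 = 3" "(2::3) + 1 = 3" "(2::3) + 2 = 1"
  "(3::3) + 1 = 1" "(3::3) + 2 = 2"
  by simp_all

lemma vcross_simps:
  "vcross a b 1 = a 2 * b 3 - a 3 * b 2" "vcross a b 2 = a 3 * b 1 - a 1 * b 3"
  "vcross a b 3 = a 1 * b 2 - a 2 * b 1"
  by (simp_all only: vcross_def index_mod_3)

lemma curl_simps:
  "curl a 1 = D 2 (a 3) - D 3 (a 2)" "curl a 2 = D 3 (a 1) - D 1 (a 3)"
  "curl a 3 = D 1 (a 2) - D 2 (a 1)"
  by (simp_all only: curl_def index_mod_3)

lemma all_3I: "P 1 \<Longrightarrow> P 2 \<Longrightarrow> P 3 \<Longrightarrow> P (i::3)"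
  using exhaust_3[of i] by auto

section \<open>Vector identities and the gradient of the Bernoulli function\<close>

lemma vcross_vcross:
  "vcross a (vcross b c) i = b i * (\<Sum>j\<in>UNIV. a j * c j) - c i * (\<Sum>j\<in>UNIV. a j * b j)"
  by (rule all_3I[of _ i]) (simp_all add: vcross_simps sum_3 algebra_simps)

text \<open>For a field of degree \<open>-1\<close> the last two terms cancel and the cross product
  of \<open>x\<close> with its curl is a gradient; for the curl itself, of degree \<open>-2\<close>,
  they add up to the field.\<close>

lemma vcross_X_curl:
  "vcross X (curl a) i = D i (\<Sum>j\<in>UNIV. X j * a j) - a i - Euler (a i)"
  by (rule all_3I[of _ i]) (simp_all add: vcross_simps curl_simps Euler_def sum_3 D_X algebra_simps)

lemma curl_curl: "curl (curl a) i = D i (\<Sum>j\<in>UNIV. D j (a j)) - Lap (a i)"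
  by (rule all_3I[of _ i]) (simp_all add: curl_simps Lap_def sum_3 D_commute algebra_simps)

lemma vcross_add_diff:
  "vcross a (\<lambda>j. b j + c j) i = vcross a b i + vcross a c i"
  "vcross a (\<lambda>j. b j - c j) i = vcross a b i - vcross a c i"
  "vcross a (\<lambda>j. s * c j) i = s * vcross a c i"
  by (simp_all add: vcross_def algebra_simps)

text \<open>Since \<open>U\<close> is divergence-free, \<open>Lap (U i)\<close> is
  \<open>- curl w i\<close>, and Lamb's form of the convection term gives
  \<open>D i h = 2 * (vcross U w i - curl w i)\<close>. The cross product of \<open>x\<close> with
  this contains only \<open>U\<close>, \<open>w\<close> and the gradient of
  \<open>z\<close>.\<close>

lemma Bernoulli_gradient:
  fixes U :: "3 \<Rightarrow> sfun" and P :: sfun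
  defines "w \<equiv> curl U" and "f \<equiv> \<Sum>j\<in>UNIV. X j * U j"
  defines "z \<equiv> \<Sum>j\<in>UNIV. X j * w j"
  defines "h \<equiv> (\<Sum>j\<in>UNIV. U j * U j) - Euler P"
  assumes EU: "\<And>i. Euler (U i) = - U i" and div: "(\<Sum>j\<in>UNIV. D j (U j)) = 0"
    and NS: "\<And>i. Lap (U i) = (\<Sum>j\<in>UNIV. U j * D j (U i)) + D i P"
  shows "D i ((\<Sum>j\<in>UNIV. X j * X j) * h - f * f - 2 * f)
    = 2 * (vcross X (\<lambda>j. D j z) i - z * vcross X U i)"
proof -
  have Df: "D i f = vcross X w i" for i
    by (simp add: w_def vcross_X_curl EU f_def del: D_sum)
  have Ew: "Euler (w i) = - (2 * w i)" for i
    unfolding w_def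
    by (rule all_3I[of _ i]) (simp_all add: curl_simps Euler_D EU algebra_simps)
  have Dz: "vcross X (curl w) i = D i z + w i" for i
    by (simp add: vcross_X_curl Ew z_def del: D_sum)
  have cw: "curl w i = - Lap (U i)" for i
    by (simp add: w_def curl_curl div del: D_sum)
  have Dh: "D i h = 2 * (vcross U w i - curl w i)" for i
  proof -
    have "D i h = 2 * ((\<Sum>j\<in>UNIV. U j * D i (U j)) + D i P)"
      unfolding h_def by (simp add: homogeneous_pressure[OF EU NS] sum_3 algebra_simps)
    also have "D i P = Lap (U i) - (\<Sum>j\<in>UNIV. U j * D j (U i))" using NS[of i] by simp
    also have "(\<Sum>j\<in>UNIV. U j * D i (U j)) + (Lap (U i) - (\<Sum>j\<in>UNIV. U j * D j (U i)))
        = vcross U w i + Lap (U i)"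
      unfolding w_def
      by (rule all_3I[of _ i]) (simp_all add: vcross_simps curl_simps sum_3 algebra_simps)
    finally show ?thesis by (simp add: cw)
  qed
  have EP: "Euler (Euler P) = - (2 * Euler P)"
    by (rule Euler_Euler_pressure[OF EU NS])
  have Eh: "(\<Sum>j\<in>UNIV. X j * D j h) = - (2 * h)"
    unfolding Euler_def[symmetric] by (simp add: h_def EP EU sum_3 algebra_simps)
  have Xh: "vcross X (\<lambda>j. D j h) i = 2 * (z * U i - f * w i - D i z - w i)" for i
    unfolding Dh vcross_add_diff
    by (simp add: vcross_vcross Dz algebra_simps flip: f_def z_def)
  \<comment> \<open>The radial part of the gradient of \<open>h\<close> is known from its degree,
    the tangential part from its cross product with \<open>x\<close>. As \<open>vcross X w\<close>
    is the gradient of \<open>f\<close>, two of the resulting terms integrate to multiples of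
    \<open>f * f\<close> and \<open>f\<close>: these are the corrections subtracted in the
    statement.\<close>
  have "(\<Sum>j\<in>UNIV. X j * X j) * D i h = X i * (\<Sum>j\<in>UNIV. X j * D j h) - vcross X (vcross X (\<lambda>j. D j h)) i"
    unfolding vcross_vcross by (simp add: algebra_simps)
  also have "vcross X (vcross X (\<lambda>j. D j h)) i
      = 2 * (z * vcross X U i - f * vcross X w i - vcross X (\<lambda>j. D j z) i - vcross X w i)"
    unfolding vcross_def[of X "vcross X (\<lambda>j. D j h)"] Xh by (simp add: vcross_def algebra_simps)
  finally have "(\<Sum>j\<in>UNIV. X j * X j) * D i h = - (2 * h * X i)
      - 2 * (z * vcross X U i - f * vcross X w i - vcross X (\<lambda>j. D j z) i - vcross X w i)"
    by (simp add: Eh algebra_simps)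
  moreover have "D i (\<Sum>j\<in>UNIV. X j * X j) = 2 * X i"
    by (rule all_3I[of _ i]) (simp_all add: sum_3 D_X)
  moreover have "D i ((\<Sum>j\<in>UNIV. X j * X j) * h - f * f - 2 * f) =
     D i (\<Sum>j\<in>UNIV. X j * X j) * h + (\<Sum>j\<in>UNIV. X j * X j) * D i h - 2 * (f + 1) * D i f"
    by (simp del: D_sum add: algebra_simps)
  ultimately show ?thesis by (simp add: Df algebra_simps)
qed

text \<open>The divergence of the cross product of \<open>x\<close> and the gradient of
  \<open>z\<close> vanishes. The triple product of \<open>x\<close>, \<open>U\<close> and that
  gradient, left over from the other term, is cancelled by the drift, to which the term along
  \<open>vcross X U\<close> contributes nothing.\<close>

lemma Bernoulli_elliptic:
  assumes "\<And>i. D i B = 2 * (vcross X (\<lambda>j. D j z) i - z * vcross X U i)"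
  shows "Lap B + (\<Sum>j\<in>UNIV. - U j * D j B) = 2 * z * (\<Sum>j\<in>UNIV. X j * curl U j)"
  by (simp add: Lap_def assms sum_3 vcross_simps curl_simps D_X D_commute algebra_simps)

lemma sfun_square_eq_0: "a * a = 0 \<Longrightarrow> a = (0::sfun)"
  by (rule sfun_eqI) (metis ev_simps(1,3) mult_eq_0_iff)

text \<open>Identities with a coefficient one half are proved in doubled form, where only integer
  coefficients occur, and then halved.\<close>

lemma sfun_double_eq: "2 * a = 2 * b \<Longrightarrow> a = (b::sfun)"
proof (rule sfun_eqI)
  fix x :: "real^3" assume e: "2 * a = 2 * b" and x: "x \<noteq> 0"
  have "ev (2 * a) x = ev (2 * b) x" by (simp only: e)
  then show "ev a x = ev b x" using x by simp
qed

lemma Bernoulli_constant: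
  fixes U :: "3 \<Rightarrow> sfun" and P :: sfun
  defines "f \<equiv> \<Sum>j\<in>UNIV. X j * U j"
  assumes EU: "\<And>i. Euler (U i) = - U i" and div: "(\<Sum>j\<in>UNIV. D j (U j)) = 0"
    and NS: "\<And>i. Lap (U i) = (\<Sum>j\<in>UNIV. U j * D j (U i)) + D i P"
  shows "(\<Sum>j\<in>UNIV. X j * curl U j) = 0"
    and "\<exists>c. (\<Sum>j\<in>UNIV. X j * X j) * ((\<Sum>j\<in>UNIV. U j * U j) - Euler P) - f * f - 2 * f = cst c"
proof -
  define z where "z = (\<Sum>j\<in>UNIV. X j * curl U j)"
  define B where "B = (\<Sum>j\<in>UNIV. X j * X j) * ((\<Sum>j\<in>UNIV. U j * U j) - Euler P) - f * f - 2 * f"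
  have DB: "D i B = 2 * (vcross X (\<lambda>j. D j z) i - z * vcross X U i)" for i
    unfolding B_def z_def f_def by (rule Bernoulli_gradient[OF EU div NS])
  have LB: "Lap B + (\<Sum>j\<in>UNIV. - U j * D j B) = 2 * (z * z)"
    using Bernoulli_elliptic[OF DB] by (simp add: z_def mult.assoc)
  have EB: "Euler B = 0"
  proof -
    have EP: "Euler (Euler P) = - (2 * Euler P)"
      by (rule Euler_Euler_pressure[OF EU NS])
    show ?thesis
      unfolding B_def f_def by (simp add: EU EP sum_3 algebra_simps)
  qed
  have "\<exists>c. B = cst c"
  proof (rule strong_max_principle[OF EB])
    fix x :: "real^3" assume "norm x = 1"
    then have "x \<noteq> 0" by auto
    then show "0 \<le> ev (Lap B + (\<Sum>j\<in>UNIV. - U j * D j B)) x" unfolding LB by simp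
  qed
  then obtain c where c: "B = cst c" by blast
  then show "\<exists>c. (\<Sum>j\<in>UNIV. X j * X j) * ((\<Sum>j\<in>UNIV. U j * U j) - Euler P) - f * f - 2 * f = cst c"
    by (auto simp: B_def)
  have "2 * (z * z) = 0" using LB by (simp add: c Lap_simps)
  then have "z * z = 0" using sfun_double_eq[of "z * z" 0] by simp
  then show "(\<Sum>j\<in>UNIV. X j * curl U j) = 0" unfolding z_def[symmetric] by (rule sfun_square_eq_0)
qed

section \<open>Reduction to the Liouville equation\<close>

abbreviation \<rho> :: sfun where "\<rho> \<equiv> rinv * rinv"

lemma square_rho: "(\<Sum>j\<in>UNIV. X j * X j) * \<rho> = 1"
  unfolding rad_square[symmetric] by (metis mult.assoc mult.commute mult_1 rad_rinv)

lemma Lap_rad: "Lap rad = 2 * rinv"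
proof -
  have "Lap rad = 3 * rinv - rinv * ((\<Sum>j\<in>UNIV. X j * X j) * \<rho>)"
    by (simp add: Lap_def D_rad D_rinv D_X sum_3 algebra_simps)
  then show ?thesis unfolding square_rho by (simp add: algebra_simps)
qed

lemma rinv_rad_cancel: "rinv * (rad * a) = a"
  by (simp only: mult.assoc[symmetric] mult.commute[of rinv rad] rad_rinv mult_1)

lemma D_rho: "D i \<rho> = - (2 * X i * \<rho> * \<rho>)"
  by (simp add: D_rinv algebra_simps)

text \<open>As \<open>curl U\<close> is orthogonal to \<open>x\<close> and the gradient of
  \<open>f\<close> is \<open>vcross X (curl U)\<close>, a second cross product with \<open>x\<close>
  recovers \<open>curl U\<close> as \<open>- \<rho>\<close> times \<open>vcross X\<close> of that
  gradient. This is precisely the curl of the radial part \<open>f * X i * \<rho>\<close>.\<close>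

lemma tangential_part_curl_free:
  fixes U :: "3 \<Rightarrow> sfun"
  defines "f \<equiv> \<Sum>j\<in>UNIV. X j * U j"
  assumes EU: "\<And>i. Euler (U i) = - U i" and z: "(\<Sum>j\<in>UNIV. X j * curl U j) = 0"
  shows "D i (U j - f * X j * \<rho>) = D j (U i - f * X i * \<rho>)"
proof -
  have Df: "D i f = vcross X (curl U) i" for i
    by (simp add: vcross_X_curl EU f_def del: D_sum)
  have xf: "vcross X (\<lambda>j. D j f) k = - ((\<Sum>j\<in>UNIV. X j * X j) * curl U k)" for k
    unfolding Df vcross_vcross by (simp add: z mult.commute)
  have c: "curl U k = - (\<rho> * vcross X (\<lambda>j. D j f) k)" for k
  proof -
    have "\<rho> * vcross X (\<lambda>j. D j f) k = - (((\<Sum>j\<in>UNIV. X j * X j) * \<rho>) * curl U k)"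
      unfolding xf by (simp only: mult_minus_right mult_ac)
    then show ?thesis by (simp only: square_rho) simp
  qed
  have D12: "D 1 (U 2) = D 2 (U 1) - \<rho> * (X 1 * D 2 f - X 2 * D 1 f)"
    and D23: "D 2 (U 3) = D 3 (U 2) - \<rho> * (X 2 * D 3 f - X 3 * D 2 f)"
    and D31: "D 3 (U 1) = D 1 (U 3) - \<rho> * (X 3 * D 1 f - X 1 * D 3 f)"
    using c[of 1] c[of 2] c[of 3] by (simp_all only: curl_simps vcross_simps diff_eq_eq) simp_all
  have e: "D i (U j - f * X j * \<rho>) = D i (U j) - (D i f * X j * \<rho> + f * D i (X j) * \<rho>
      - f * X j * (2 * X i * \<rho> * \<rho>))" for i j
    unfolding D_diff D_mult[of i "f * X j" \<rho>] D_rho by (simp add: algebra_simps)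
  have "D 1 (U 2 - f * X 2 * \<rho>) = D 2 (U 1 - f * X 1 * \<rho>)"
    "D 2 (U 3 - f * X 3 * \<rho>) = D 3 (U 2 - f * X 2 * \<rho>)"
    "D 3 (U 1 - f * X 1 * \<rho>) = D 1 (U 3 - f * X 3 * \<rho>)"
    unfolding e D12 D23 D31 by (simp_all add: D_X algebra_simps)
  then show ?thesis
    using exhaust_3[of i] exhaust_3[of j] by (elim disjE) (simp_all only:)
qed

text \<open>On the unit sphere the last equations combine to the Liouville equation: the Laplacian
  of \<open>\<phi>\<close> is \<open>2 - A * exp \<phi>\<close>. Subtracting the radial part makes
  \<open>\<phi>\<close> of degree \<open>0\<close>, as the maximum principle requires.\<close>

lemma liouville_system:
  fixes U :: "3 \<Rightarrow> sfun" and P :: sfun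
  defines "f \<equiv> \<Sum>j\<in>UNIV. X j * U j"
  assumes EU: "\<And>i. Euler (U i) = - U i" and div: "(\<Sum>j\<in>UNIV. D j (U j)) = 0"
    and NS: "\<And>i. Lap (U i) = (\<Sum>j\<in>UNIV. U j * D j (U i)) + D i P"
  shows "\<exists>\<phi> A. A > 0 \<and> (\<forall>i. D i \<phi> = U i - f * X i * \<rho>) \<and> Lap \<phi> = - (f * \<rho>) \<and> Euler \<phi> = 0 \<and>
    f + 2 = cst A * expf \<phi>"
proof -
  define V where "V i = U i - f * X i * \<rho>" for i
  have z: "(\<Sum>j\<in>UNIV. X j * curl U j) = 0" by (rule Bernoulli_constant(1)[OF EU div NS])
  obtain \<phi> where \<phi>: "\<And>i. D i \<phi> = V i"
    using curl_free_imp_gradient[of V] tangential_part_curl_free[OF EU z]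
    unfolding V_def f_def by blast
  have Ef: "Euler f = 0" by (simp add: f_def EU sum_3)
  have E\<phi>: "Euler \<phi> = 0"
  proof -
    have "Euler \<phi> = f - f * ((\<Sum>j\<in>UNIV. X j * X j) * \<rho>)"
      by (simp add: Euler_def \<phi> V_def f_def sum_3 algebra_simps)
    then show ?thesis unfolding square_rho by simp
  qed
  have L\<phi>: "Lap \<phi> = - (f * \<rho>)"
  proof -
    have "Lap \<phi> = (\<Sum>j\<in>UNIV. D j (U j)) - Euler f * \<rho> - 3 * f * \<rho> + 2 * f * \<rho> * ((\<Sum>j\<in>UNIV. X j * X j) * \<rho>)"
      by (simp add: Lap_def \<phi> V_def Euler_def D_rinv D_X sum_3 algebra_simps)
    then show ?thesis unfolding square_rho Ef div by (simp add: algebra_simps)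
  qed
  obtain c where c: "(\<Sum>j\<in>UNIV. X j * X j) * ((\<Sum>j\<in>UNIV. U j * U j) - Euler P) - f * f - 2 * f = cst c"
    using Bernoulli_constant(2)[OF EU div NS] unfolding f_def by blast
  define h where "h = (\<Sum>j\<in>UNIV. U j * U j) - Euler P"
  have h: "h = (f * f + 2 * f + cst c) * \<rho>"
  proof -
    have "(f * f + 2 * f + cst c) * \<rho> = h * ((\<Sum>j\<in>UNIV. X j * X j) * \<rho>)"
      unfolding c[symmetric] h_def[symmetric] by (simp add: algebra_simps)
    then show ?thesis unfolding square_rho by simp
  qed
  have Lf: "Lap f = (\<Sum>j\<in>UNIV. U j * D j f) - h"
  proof -
    have "Lap f = (\<Sum>i\<in>UNIV. X i * Lap (U i)) + 2 * (\<Sum>j\<in>UNIV. D j (U j))"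
      unfolding f_def by (simp add: Lap_simps sum_3 D_X algebra_simps)
    also have "\<dots> = (\<Sum>j\<in>UNIV. U j * D j f) - h"
      unfolding div NS by (simp add: f_def h_def Euler_def sum_3 D_X algebra_simps)
    finally show ?thesis .
  qed
  define g where "g = (f + 2) * expf (- \<phi>)"
  have Vf: "(\<Sum>j\<in>UNIV. V j * D j f) = (\<Sum>j\<in>UNIV. U j * D j f)"
  proof -
    have "(\<Sum>j\<in>UNIV. V j * D j f) = (\<Sum>j\<in>UNIV. U j * D j f) - f * \<rho> * Euler f"
      by (simp add: V_def Euler_def sum_3 algebra_simps)
    then show ?thesis by (simp add: Ef)
  qed
  \<comment> \<open>The drift \<open>V\<close>, the gradient of \<open>\<phi>\<close>, is the one
    for which the squared gradients of \<open>\<phi>\<close> cancel. What remains is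
    \<open>- h + (f + 2) * f * \<rho>\<close>, which the constancy of the Bernoulli function reduces
    to \<open>- cst c * \<rho>\<close>.\<close>
  have Lg: "Lap g + (\<Sum>j\<in>UNIV. V j * D j g) = - (cst c * (\<rho> * expf (- \<phi>)))"
  proof -
    have "Lap g + (\<Sum>j\<in>UNIV. V j * D j g)
        = expf (- \<phi>) * (Lap f - (\<Sum>j\<in>UNIV. V j * D j f) - (f + 2) * Lap \<phi>)"
      unfolding g_def by (simp add: Lap_simps \<phi> sum_3 Lap_def[of 2] algebra_simps)
    also have "\<dots> = expf (- \<phi>) * (- h + (f + 2) * f * \<rho>)"
      unfolding Vf Lf L\<phi> by (simp add: algebra_simps)
    also have "\<dots> = - (cst c * (\<rho> * expf (- \<phi>)))" unfolding h by (simp add: algebra_simps)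
    finally show ?thesis .
  qed
  have Eg: "Euler g = 0" by (simp add: g_def Ef E\<phi>)
  \<comment> \<open>The right-hand side has the constant sign of \<open>- c\<close>; for positive
    \<open>c\<close> the maximum principle is applied to \<open>- g\<close>.\<close>
  have "\<exists>A. g = cst A"
  proof (cases "c \<le> 0")
    case True
    show ?thesis
    proof (rule strong_max_principle[OF Eg, of V])
      fix x :: "real^3" assume x: "norm x = 1"
      then have "x \<noteq> 0" by auto
      then show "0 \<le> ev (Lap g + (\<Sum>j\<in>UNIV. V j * D j g)) x"
        unfolding Lg using True x by (simp add: ev_nz_simps ev_rinv_sphere mult_nonpos_nonneg)
    qed
  next
    case False
    have L: "Lap (- g) + (\<Sum>j\<in>UNIV. V j * D j (- g)) = cst c * (\<rho> * expf (- \<phi>))"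
      using arg_cong[OF Lg, of uminus] by (simp add: Lap_simps sum_3)
    have "\<exists>A. - g = cst A"
    proof (rule strong_max_principle[of _ V])
      fix x :: "real^3" assume x: "norm x = 1"
      then have "x \<noteq> 0" by auto
      then show "0 \<le> ev (Lap (- g) + (\<Sum>j\<in>UNIV. V j * D j (- g))) x"
        unfolding L using False x by (simp add: ev_nz_simps ev_rinv_sphere)
    qed (simp add: Eg)
    then show ?thesis by (metis cst_simps(3) minus_minus)
  qed
  then obtain A where A: "g = cst A" by blast
  have fA: "f + 2 = cst A * expf \<phi>"
  proof -
    have "cst A * expf \<phi> = (f + 2) * (expf \<phi> * expf (- \<phi>))"
      unfolding A[symmetric] g_def by (simp only: mult_ac)
    then show ?thesis unfolding expf_minus by simp
  qed
  \<comment> \<open>Otherwise \<open>f \<le> - 2\<close>, so \<open>\<phi>\<close> is strictly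
    subharmonic on the sphere; but then it is constant, which forces \<open>f = 0\<close>. This
    replaces an appeal to the Gauss-Bonnet theorem.\<close>
  have "A > 0"
  proof (rule ccontr)
    assume "\<not> A > 0"
    have f2: "ev f x \<le> - 2" if "x \<noteq> 0" for x
    proof -
      have "ev (f + 2) x = A * exp (ev \<phi> x)" unfolding fA using that by (simp add: ev_nz_simps)
      also have "\<dots> \<le> 0" using \<open>\<not> A > 0\<close> by (simp add: mult_nonpos_nonneg)
      finally show ?thesis using that by simp
    qed
    have "\<exists>c. \<phi> = cst c"
    proof (rule strong_max_principle[OF E\<phi>, of "\<lambda>i. 0"])
      fix x :: "real^3" assume x: "norm x = 1"
      then have "x \<noteq> 0" by auto
      then show "0 \<le> ev (Lap \<phi> + (\<Sum>i\<in>UNIV. 0 * D i \<phi>)) x"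
        using f2[of x] x by (simp add: L\<phi> ev_rinv_sphere)
    qed
    then have "f * \<rho> = 0" using L\<phi> by (auto simp: Lap_simps)
    then have "ev (f * \<rho>) (axis 1 1) = 0" by simp
    then have "ev f (axis 1 1) = 0" by (simp add: ev_rinv_sphere)
    moreover have "ev f (axis 1 1) \<le> - 2" by (rule f2) simp
    ultimately show False by simp
  qed
  then show ?thesis using \<phi> L\<phi> E\<phi> fA unfolding V_def by blast
qed

section \<open>Solving the Liouville equation\<close>

text \<open>The Hessian of a function of degree \<open>1\<close> annihilates \<open>x\<close>, hence
  is effectively a 2 by 2 matrix, and the square of its trace is at most twice the sum of its
  squared entries. The defect is half the sum of the squares of \<open>S\<close>, which makes the
  sign of \<open>Lap N\<close> and the equality case explicit.\<close>

lemma homogeneous_degree_1_rigidity: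
  assumes EF: "Euler F = F" and pos: "\<And>x. x \<noteq> 0 \<Longrightarrow> ev F x > 0"
    and eq: "F * Lap F = (\<Sum>j\<in>UNIV. D j F * D j F) + cst k"
  shows "\<exists>\<alpha> b. F = cst \<alpha> * rad + lin b"
proof -
  define N where "N = Lap F"
  \<comment> \<open>\<open>S\<close> is twice the trace-free part of the Hessian of \<open>F\<close> on the plane orthogonal to \<open>x\<close>;
    its remaining entries vanish by homogeneity.\<close>
  define S where "S i j = 2 * D i (D j F) - N * ((if i = j then 1 else 0) - X i * X j * \<rho>)" for i j
  have EN: "Euler N = - N" by (simp add: N_def Euler_Lap EF)
  have LD: "Lap (D j F * D j F) = 2 * (D j F * D j N) + 2 * (\<Sum>i\<in>UNIV. D i (D j F) * D i (D j F))" for j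
  proof -
    have "Lap (D j F) = D j N" by (simp only: N_def D_Lap)
    then show ?thesis by (simp only: Lap_simps) (simp add: algebra_simps)
  qed
  have "Lap (F * N) = Lap ((\<Sum>j\<in>UNIV. D j F * D j F) + cst k)"
    unfolding N_def eq ..
  also have "\<dots> = (\<Sum>j\<in>UNIV. 2 * (D j F * D j N) + 2 * (\<Sum>i\<in>UNIV. D i (D j F) * D i (D j F)))"
    by (simp only: sum_3[of "\<lambda>j. D j F * D j F"] Lap_simps(1,5) LD) (simp add: sum_3 algebra_simps)
  also have "Lap (F * N) = N * N + 2 * (\<Sum>j\<in>UNIV. D j F * D j N) + F * Lap N"
    by (simp only: Lap_simps N_def)
  finally have FN: "F * Lap N = 2 * (\<Sum>i\<in>UNIV. \<Sum>j\<in>UNIV. D i (D j F) * D i (D j F)) - N * N"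
    by (simp add: sum_3 D_commute algebra_simps)
  have H: "(\<Sum>j\<in>UNIV. X j * D j (D i F)) = 0" for i
    unfolding Euler_def[symmetric] by (simp add: Euler_D EF)
  have SS: "(\<Sum>i\<in>UNIV. \<Sum>j\<in>UNIV. S i j * S i j) = 2 * (F * Lap N)"
  proof -
    have "(\<Sum>i\<in>UNIV. \<Sum>j\<in>UNIV. S i j * S i j)
       = 4 * (\<Sum>i\<in>UNIV. \<Sum>j\<in>UNIV. D i (D j F) * D i (D j F)) - 4 * N * Lap F
         + 4 * N * \<rho> * (\<Sum>i\<in>UNIV. X i * (\<Sum>j\<in>UNIV. X j * D j (D i F)))
         + N * N * (3 - 2 * ((\<Sum>j\<in>UNIV. X j * X j) * \<rho>) + ((\<Sum>j\<in>UNIV. X j * X j) * \<rho>) * ((\<Sum>j\<in>UNIV. X j * X j) * \<rho>))"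
      by (simp add: S_def Lap_def sum_3 D_commute algebra_simps)
    then show ?thesis unfolding FN square_rho H N_def[symmetric] by (simp add: algebra_simps)
  qed
  \<comment> \<open>For \<open>N\<close> of degree \<open>-1\<close> the term from
    \<open>Lap rad\<close> and the cross term cancel, so multiplication by \<open>rad\<close> gives
    a function of degree \<open>0\<close> without losing the sign.\<close>
  have LP: "Lap (rad * N) = rad * Lap N"
  proof -
    have "(\<Sum>i\<in>UNIV. D i rad * D i N) = rinv * Euler N"
      by (simp add: D_rad Euler_def sum_3 algebra_simps)
    then show ?thesis unfolding Lap_simps Lap_rad EN by (simp add: algebra_simps)
  qed
  have LN: "ev (F * Lap N) x \<ge> 0" for x
  proof (cases "x = 0")
    case False
    have "0 \<le> ev (\<Sum>i\<in>UNIV. \<Sum>j\<in>UNIV. S i j * S i j) x" by (simp add: sum_nonneg)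
    then show ?thesis unfolding SS using False by simp
  qed simp
  have "\<exists>c. rad * N = cst c"
  proof (rule strong_max_principle[of _ "\<lambda>i. 0"])
    fix x :: "real^3" assume x: "norm x = 1"
    then have x0: "x \<noteq> 0" by auto
    have "ev (Lap N) x \<ge> 0" using LN[of x] pos[OF x0] by (simp add: zero_le_mult_iff)
    then show "0 \<le> ev (Lap (rad * N) + (\<Sum>i\<in>UNIV. 0 * D i (rad * N))) x"
      unfolding LP using x by simp
  qed (simp add: EN)
  then obtain c where c: "rad * N = cst c" by blast
  have N: "N = cst c * rinv"
    unfolding c[symmetric] by (simp only: mult.commute[of _ rinv] rinv_rad_cancel)
  have "rad * Lap N = 0" using LP c by (simp add: Lap_simps)
  then have LN0: "Lap N = 0" using rinv_rad_cancel[of "Lap N"] by simp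
  have S0: "S i j = 0" for i j
  proof (rule sfun_eqI)
    fix x :: "real^3" assume "x \<noteq> 0"
    have "ev (\<Sum>i\<in>UNIV. \<Sum>j\<in>UNIV. S i j * S i j) x = 0" unfolding SS LN0 by simp
    then have "\<forall>i. (\<Sum>j\<in>UNIV. ev (S i j) x * ev (S i j) x) = 0"
      by (simp add: sum_nonneg_eq_0_iff sum_nonneg)
    then show "ev (S i j) x = ev 0 x" by (simp add: sum_nonneg_eq_0_iff)
  qed
  \<comment> \<open>The Hessian of \<open>rad\<close> is \<open>rinv\<close> times the projection
    orthogonal to \<open>x\<close>, and \<open>N\<close> is \<open>cst c * rinv\<close>; so
    \<open>S = 0\<close> says that \<open>F\<close> and \<open>cst (c / 2) * rad\<close> have the
    same Hessian.\<close>
  define T where "T = F - cst (c / 2) * rad"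
  have DT: "D i (D j T) = 0" for i j
  proof (rule sfun_double_eq)
    have c2: "2 * cst (c / 2) = cst c" by (simp add: numeral_sfun flip: cst_simps)
    have "D i (D j T) = D i (D j F) - cst (c / 2) * D i (D j rad)" by (simp add: T_def)
    then have "2 * D i (D j T) = 2 * D i (D j F) - 2 * cst (c / 2) * D i (D j rad)"
      by (simp only: right_diff_distrib mult.assoc)
    then have "2 * D i (D j T) = 2 * D i (D j F) - cst c * D i (D j rad)" unfolding c2 .
    also have "D i (D j rad) = rinv * ((if i = j then 1 else 0) - X i * X j * \<rho>)"
      by (simp add: D_rad D_rinv D_X algebra_simps)
    also have "2 * D i (D j F) - cst c * (rinv * ((if i = j then 1 else 0) - X i * X j * \<rho>)) = S i j"
      unfolding S_def N by (simp only: mult.assoc)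
    finally show "2 * D i (D j T) = 2 * 0" by (simp add: S0)
  qed
  have "\<forall>j. \<exists>b. D j T = cst b" using const_if_D_zero DT by blast
  then obtain b where b: "\<And>j. D j T = cst (b j)" by metis
  \<comment> \<open>Degree \<open>1\<close> excludes the additive constant of an affine
    function.\<close>
  have "T = Euler T" by (simp add: T_def EF)
  also have "\<dots> = lin (\<chi> j. b j)" by (simp add: Euler_def b lin_def mult.commute)
  finally have "F = cst (c / 2) * rad + lin (\<chi> j. b j)" by (simp add: T_def algebra_simps)
  then show ?thesis by blast
qed

text \<open>With \<open>\<phi> = - 2 * ln (F / |x|)\<close> the tangential part of \<open>U\<close>
  on the sphere is \<open>2 * x\<close> minus twice the gradient of \<open>ln F\<close>, and
  \<open>f + 2 = A / F\<^sup>2\<close>. Adding the radial part cancels \<open>2 * x\<close>, and the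
  formula follows with \<open>k = A / 2\<close>.\<close>

lemma landau_formula:
  fixes U :: "3 \<Rightarrow> sfun" and P :: sfun
  assumes EU: "\<And>i. Euler (U i) = - U i" and div: "(\<Sum>j\<in>UNIV. D j (U j)) = 0"
    and NS: "\<And>i. Lap (U i) = (\<Sum>j\<in>UNIV. U j * D j (U i)) + D i P"
  shows "\<exists>\<alpha> b k. k > 0 \<and> k = \<alpha>\<^sup>2 - b \<bullet> b \<and> (\<forall>x. norm x = 1 \<longrightarrow> \<alpha> + b \<bullet> x > 0 \<and>
     (\<forall>i. ev (U i) x = - 2 * (\<alpha> * x $ i + b $ i) / (\<alpha> + b \<bullet> x) + 2 * k * x $ i / (\<alpha> + b \<bullet> x)\<^sup>2))"
proof -
  define f where "f = (\<Sum>j\<in>UNIV. X j * U j)"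
  obtain \<phi> A where A: "A > 0" and \<phi>: "\<And>i. D i \<phi> = U i - f * X i * \<rho>" "Lap \<phi> = - (f * \<rho>)" "Euler \<phi> = 0"
    and fA: "f + 2 = cst A * expf \<phi>"
    using liouville_system[OF EU div NS] unfolding f_def by blast
  define \<psi> where "\<psi> = cst (- 1 / 2) * \<phi>"
  define W where "W = expf \<psi>"
  define F where "F = rad * W"
  have half: "cst (- 1 / 2) * 2 = - 1" by (simp add: numeral_sfun flip: cst_simps)
  have psi2: "2 * (cst (- 1 / 2) * a) = - a" for a
  proof -
    have "2 * (cst (- 1 / 2) * a) = cst (- 1 / 2) * 2 * a" by (simp only: mult_ac)
    then show ?thesis unfolding half by simp
  qed
  have WW: "W * W * expf \<phi> = 1"
  proof -
    have "2 * \<psi> = - \<phi>" by (simp only: \<psi>_def psi2)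
    then have "\<psi> + \<psi> + \<phi> = 0" by (simp only: mult_2[symmetric]) simp
    moreover have "expf 0 = 1" by (rule sfun_eqI) (simp add: ev_nz_simps)
    moreover have "W * W * expf \<phi> = expf (\<psi> + \<psi> + \<phi>)" by (simp only: W_def expf_add)
    ultimately show ?thesis by (simp only:)
  qed
  have DF: "2 * D i F = (2 * X i * \<rho> - (U i - f * X i * \<rho>)) * F" for i
  proof -
    have "2 * D i F = 2 * X i * rinv * W + rad * W * (2 * (cst (- 1 / 2) * D i \<phi>))"
      by (simp add: F_def W_def \<psi>_def D_rad algebra_simps)
    also have "2 * X i * rinv * W = 2 * X i * rinv * W * (rad * rinv)" by (simp add: rad_rinv)
    finally show ?thesis unfolding psi2 \<phi> F_def by (simp add: algebra_simps)
  qed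
  have EF: "Euler F = F" by (simp add: F_def W_def \<psi>_def \<phi>)
  have Fpos: "ev F x > 0" if "x \<noteq> 0" for x using that by (simp add: F_def W_def ev_nz_simps)
  have r2: "rad * rad * \<rho> = 1" by (metis rad_square square_rho)
  have DF': "D i F = X i * rinv * W + F * D i \<psi>" for i
    by (simp add: F_def W_def D_rad algebra_simps)
  have eq: "F * Lap F = (\<Sum>j\<in>UNIV. D j F * D j F) + cst (A / 2)"
  proof (rule sfun_double_eq)
    define G where "G = (\<Sum>j\<in>UNIV. D j \<psi> * D j \<psi>)"
    have E\<psi>: "Euler \<psi> = 0" by (simp add: \<psi>_def \<phi>)
    have "Lap F = W * (2 * rinv + 2 * rinv * Euler \<psi> + rad * (Lap \<psi> + G))"
      by (simp add: F_def W_def Lap_simps Lap_rad G_def D_rad Euler_def sum_3 algebra_simps)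
    then have LF: "Lap F = W * (2 * rinv + rad * (Lap \<psi> + G))" by (simp add: E\<psi>)
    have "(\<Sum>j\<in>UNIV. D j F * D j F) = W * W * ((\<Sum>j\<in>UNIV. X j * X j) * \<rho> + 2 * rad * rinv * Euler \<psi> + rad * rad * G)"
      unfolding DF' unfolding F_def G_def Euler_def by (simp add: sum_3 algebra_simps)
    then have GF: "(\<Sum>j\<in>UNIV. D j F * D j F) = W * W * (1 + rad * rad * G)"
      by (simp only: E\<psi> square_rho) simp
    have "F * Lap F = W * W * (2 * (rad * rinv) + rad * rad * (Lap \<psi> + G))"
      unfolding LF unfolding F_def by (simp add: algebra_simps)
    then have FL: "F * Lap F = (\<Sum>j\<in>UNIV. D j F * D j F) + W * W * (1 + rad * rad * Lap \<psi>)"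
      unfolding GF rad_rinv by (simp add: algebra_simps)
    have "Lap \<psi> = cst (- 1 / 2) * Lap \<phi>" by (simp add: \<psi>_def Lap_simps)
    then have "2 * Lap \<psi> = f * \<rho>" using psi2[of "Lap \<phi>"] by (simp add: \<phi>)
    have "2 * (W * W * (1 + rad * rad * Lap \<psi>)) = W * W * (2 + rad * rad * (2 * Lap \<psi>))"
      by (simp add: algebra_simps)
    also have "\<dots> = W * W * (2 + f * (rad * rad * \<rho>))"
      unfolding \<open>2 * Lap \<psi> = f * \<rho>\<close> by (simp add: algebra_simps)
    also have "\<dots> = W * W * (f + 2)" unfolding r2 by (simp add: add.commute)
    also have "\<dots> = cst A * (W * W * expf \<phi>)" unfolding fA by (simp only: mult_ac)
    also have "\<dots> = cst A" unfolding WW by simp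
    also have "\<dots> = 2 * cst (A / 2)" by (simp add: numeral_sfun flip: cst_simps)
    finally show "2 * (F * Lap F) = 2 * ((\<Sum>j\<in>UNIV. D j F * D j F) + cst (A / 2))"
      unfolding FL by (simp only: distrib_left)
  qed
  obtain \<alpha> b where F: "F = cst \<alpha> * rad + lin b"
    using homogeneous_degree_1_rigidity[OF EF Fpos eq] by blast
  have Fx: "ev F x = \<alpha> + b \<bullet> x" if "norm x = 1" for x
    unfolding F using that by (cases "x = 0") (auto simp: ev_nz_simps ev_lin)
  have DFx: "ev (D i F) x = \<alpha> * x $ i + b $ i" if "norm x = 1" for x i
    unfolding F using that by (cases "x = 0") (auto simp: ev_nz_simps ev_rinv_sphere D_rad)
  have LFx: "ev (Lap F) x = 2 * \<alpha>" if "norm x = 1" for x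
  proof -
    have "Lap F = cst \<alpha> * (2 * rinv)"
      unfolding F by (simp only: Lap_simps Lap_rad) (simp add: lin_def sum_3 Lap_simps)
    then show ?thesis using that by (cases "x = 0") (auto simp: ev_nz_simps ev_rinv_sphere)
  qed
  \<comment> \<open>The equation for \<open>F\<close> is evaluated at a single unit vector; the
    terms linear in \<open>b\<close> cancel.\<close>
  have k: "A / 2 = \<alpha>\<^sup>2 - b \<bullet> b"
  proof -
    define x :: "real^3" where "x = axis 1 1"
    have x: "norm x = 1" "x \<noteq> 0" by (auto simp: x_def)
    have "ev (F * Lap F) x = ev ((\<Sum>j\<in>UNIV. D j F * D j F) + cst (A / 2)) x" unfolding eq ..
    then have "(\<alpha> + b \<bullet> x) * (2 * \<alpha>) = (\<Sum>j\<in>UNIV. (\<alpha> * x $ j + b $ j) * (\<alpha> * x $ j + b $ j)) + A / 2"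
      using x by (simp add: Fx DFx LFx ev_nz_simps)
    also have "(\<Sum>j\<in>UNIV. (\<alpha> * x $ j + b $ j) * (\<alpha> * x $ j + b $ j)) = (\<alpha> *\<^sub>R x + b) \<bullet> (\<alpha> *\<^sub>R x + b)"
      by (simp add: inner_vec_def)
    also have "\<dots> = \<alpha>\<^sup>2 * (x \<bullet> x) + b \<bullet> b + 2 * \<alpha> * (b \<bullet> x)"
      by (simp add: inner_simps inner_commute power2_eq_square algebra_simps)
    also have "x \<bullet> x = 1" using x by (simp add: norm_eq_1)
    finally show ?thesis by (simp add: power2_eq_square algebra_simps)
  qed
  have "ev (U i) x = - 2 * (\<alpha> * x $ i + b $ i) / (\<alpha> + b \<bullet> x) + 2 * (A / 2) * x $ i / (\<alpha> + b \<bullet> x)\<^sup>2"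
    "\<alpha> + b \<bullet> x > 0" if x: "norm x = 1" for x i
  proof -
    have x0: "x \<noteq> 0" using x by auto
    show p: "\<alpha> + b \<bullet> x > 0" using Fpos[OF x0] Fx[OF x] by simp
    have Wx: "ev W x = \<alpha> + b \<bullet> x" using Fx[OF x] x by (simp add: F_def)
    have "ev (2 * D i F) x = ev ((2 * X i * \<rho> - (U i - f * X i * \<rho>)) * F) x" unfolding DF ..
    then have e1: "2 * (\<alpha> * x $ i + b $ i) = (2 * x $ i - (ev (U i) x - ev f x * x $ i)) * (\<alpha> + b \<bullet> x)"
      using x0 x by (simp add: DFx Fx ev_rinv_sphere)
    have "ev (W * W * (f + 2)) x = ev (cst A * (W * W * expf \<phi>)) x" unfolding fA by (simp only: mult_ac)
    then have e2: "(\<alpha> + b \<bullet> x)\<^sup>2 * (ev f x + 2) = A"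
      unfolding WW using x0 by (simp add: Wx ev_nz_simps power2_eq_square)
    then have "ev f x = A / (\<alpha> + b \<bullet> x)\<^sup>2 - 2" using p by (simp add: field_simps)
    moreover have "ev (U i) x = (ev f x + 2) * x $ i - 2 * (\<alpha> * x $ i + b $ i) / (\<alpha> + b \<bullet> x)"
      using e1 p by (simp add: field_simps)
    ultimately show "ev (U i) x = - 2 * (\<alpha> * x $ i + b $ i) / (\<alpha> + b \<bullet> x) + 2 * (A / 2) * x $ i / (\<alpha> + b \<bullet> x)\<^sup>2"
      by (simp add: diff_divide_distrib add_divide_distrib)
  qed
  note U = this
  show ?thesis
    by (rule exI[of _ \<alpha>], rule exI[of _ b], rule exI[of _ "A / 2"])
      (intro conjI allI impI U k, use A in simp_all)
qed

section \<open>Landau solutions\<close>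

lemma ev_D_component:
  fixes w :: "real^3 \<Rightarrow> real^3"
  assumes w: "smooth_on w (- {0})" and a: "\<And>y. y \<noteq> 0 \<Longrightarrow> ev a y = w y $ j" and x: "x \<noteq> 0"
  shows "ev (D i a) x = partial i w x $ j"
proof -
  have d: "(w has_derivative frechet_derivative w (at x)) (at x)"
    using smooth_on_has_derivative[OF w] x by auto
  have "(ev a has_derivative (\<lambda>h. frechet_derivative w (at x) h $ j)) (at x)"
    by (rule has_derivative_cong_punctured[OF bounded_linear.has_derivative[OF bounded_linear_vec_nth d] x a])
  then show ?thesis using x by (simp add: D.rep_eq partial_unique) (simp add: partial_def)
qed

lemma ev_D_scalar:
  assumes w: "smooth_on w (- {0})" and a: "\<And>y. y \<noteq> 0 \<Longrightarrow> ev a y = w y" and x: "x \<noteq> 0"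
  shows "ev (D i a) x = partial i w x"
proof -
  have d: "(w has_derivative frechet_derivative w (at x)) (at x)"
    using smooth_on_has_derivative[OF w] x by auto
  have "(ev a has_derivative frechet_derivative w (at x)) (at x)"
    by (rule has_derivative_cong_punctured[OF d x a])
  then show ?thesis using x by (simp add: D.rep_eq partial_unique) (simp add: partial_def)
qed

lemma ex_sfun:
  fixes w :: "real^3 \<Rightarrow> real"
  assumes "smooth_on w (- {0})"
  shows "\<exists>a. \<forall>x. x \<noteq> 0 \<longrightarrow> ev a x = w x"
proof (intro exI allI impI)
  fix x :: "real^3" assume "x \<noteq> 0"
  then show "ev (Abs_sfun (\<lambda>x. if x = 0 then 0 else w x)) x = w x"
    using smooth_punctured_if[OF assms] by (simp add: Abs_sfun_inverse)
qed

text \<open>Differentiate \<open>l * ev a (l *\<^sub>R x)\<close>, which is constant in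
  \<open>l > 0\<close>, at \<open>l = 1\<close>.\<close>

lemma Euler_homogeneous_neg1:
  assumes "\<And>l x. l > 0 \<Longrightarrow> x \<noteq> 0 \<Longrightarrow> l * ev a (l *\<^sub>R x) = ev a x"
  shows "Euler a = - a"
proof (rule sfun_eqI)
  fix x :: "real^3" assume x: "x \<noteq> 0"
  have "((\<lambda>l. ev a (l *\<^sub>R x)) has_derivative
      (\<lambda>h. \<Sum>i\<in>UNIV. (h *\<^sub>R x) $ i * ev (D i a) (1 *\<^sub>R x))) (at 1)"
    by (rule has_derivative_compose[of "\<lambda>s. s *\<^sub>R x" _ _ UNIV "ev a"])
      (use x in \<open>auto intro!: derivative_eq_intros ev_has_derivative\<close>)
  then have "((\<lambda>l. ev a (l *\<^sub>R x)) has_real_derivative ev (Euler a) x) (at 1)"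
    unfolding has_field_derivative_def
    by (rule has_derivative_eq_rhs) (simp add: fun_eq_iff Euler_def sum_distrib_left mult_ac)
  then have "((\<lambda>l. l * ev a (l *\<^sub>R x)) has_real_derivative 1 * ev a (1 *\<^sub>R x) + ev (Euler a) x * 1) (at 1)"
    by (intro DERIV_mult DERIV_ident)
  moreover have "((\<lambda>l. l * ev a (l *\<^sub>R x)) has_real_derivative 0) (at 1)"
    by (rule has_field_derivative_transform_within_open[of "\<lambda>l. ev a x" _ _ "{0<..}"])
      (use x assms in auto)
  ultimately have "1 * ev a (1 *\<^sub>R x) + ev (Euler a) x * 1 = 0" by (rule DERIV_unique)
  then show "ev (Euler a) x = ev (- a) x" by simp
qed

lemma ex_orthonormal_frame:
  assumes "norm (a :: real^3) = 1"
  shows "\<exists>b. orthonormal_frame b \<and> b 3 = a"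
proof -
  obtain f where f: "orthogonal_transformation f" "f (axis (3::3) (1::real)) = a"
    using orthogonal_transformation_exists_1[of "axis (3::3) (1::real)" a] assms by auto
  have "orthonormal_frame (\<lambda>i. f (axis i 1))"
    using f(1) by (simp add: orthonormal_frame_def orthogonal_transformation_def inner_axis_axis)
  then show ?thesis using f(2) by blast
qed

lemma rotation_matrix_inner:
  "rotation_matrix Q \<Longrightarrow> (Q *v x) \<bullet> (Q *v y) = x \<bullet> (y :: real^'n)"
  by (metis orthogonal_transformation_def orthogonal_transformation_matrix
      matrix_of_matrix_vector_mul matrix_vector_mul_linear rotation_matrix_def)

theorem theorem1:
  fixes u :: "real^3 \<Rightarrow> real^3" and p :: "real^3 \<Rightarrow> real"
  assumes u_smooth: "smooth_on u (- {0})"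
    and p_smooth: "smooth_on p (- {0})"
    and nonzero: "\<exists>x. x \<noteq> 0 \<and> u x \<noteq> 0"
    and navier_stokes: "steady_navier_stokes_on (- {0}) u p"
    and homogeneous: "\<And>l x. l > 0 \<Longrightarrow> x \<noteq> 0 \<Longrightarrow> l *\<^sub>R u (l *\<^sub>R x) = u x"
  shows "\<exists>b \<kappa>. orthonormal_frame b \<and> \<kappa> \<noteq> 0 \<and> axisymmetric_about (b 3) u \<and>
    (\<forall>x\<in>sphere 0 1. \<forall>\<theta>\<in>{0..pi}. \<forall>\<psi>. x = spherical_point b \<theta> \<psi> \<longrightarrow>
      u x = (- 2 * sin \<theta> / (coth \<kappa> - cos \<theta>)) *\<^sub>R e_theta b \<theta> \<psi>
          + (2 / (cosh \<kappa> - sinh \<kappa> * cos \<theta>)\<^sup>2 - 2) *\<^sub>R x)"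
proof -
  have "smooth_on (\<lambda>x. u x $ i) (- {0})" for i
    using u_smooth Ck_on_bounded_linear_comp[OF open_punctured bounded_linear_vec_nth]
    unfolding smooth_on_def by blast
  then have "\<forall>i. \<exists>a. \<forall>x. x \<noteq> 0 \<longrightarrow> ev a x = u x $ i" using ex_sfun by blast
  then obtain U where U: "\<And>i x. x \<noteq> 0 \<Longrightarrow> ev (U i) x = u x $ i" by metis
  obtain P where P: "\<And>x. x \<noteq> 0 \<Longrightarrow> ev P x = p x" using ex_sfun[OF p_smooth] by metis
  have DU: "ev (D i (U j)) x = partial i u x $ j" if "x \<noteq> 0" for i j x
    by (rule ev_D_component[OF u_smooth U that])
  have DDU: "ev (D i (D k (U j))) x = partial i (partial k u) x $ j" if "x \<noteq> 0" for i j k x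
    by (rule ev_D_component[OF smooth_on_partial[OF u_smooth] DU that])
  have DP: "ev (D i P) x = partial i p x" if "x \<noteq> 0" for i x
    by (rule ev_D_scalar[OF p_smooth P that])
  have EU: "Euler (U i) = - U i" for i
  proof (rule Euler_homogeneous_neg1)
    fix l :: real and x :: "real^3" assume "l > 0" "x \<noteq> 0"
    then show "l * ev (U i) (l *\<^sub>R x) = ev (U i) x"
      using arg_cong[OF homogeneous[of l x], of "\<lambda>v. v $ i"] by (simp add: U)
  qed
  have div: "(\<Sum>j\<in>UNIV. D j (U j)) = 0"
  proof (rule sfun_eqI)
    fix x :: "real^3" assume x: "x \<noteq> 0"
    have "partial j (\<lambda>y. u y $ j) x = ev (D j (U j)) x" for j
      using \<open>\<And>i. smooth_on (\<lambda>x. u x $ i) (- {0})\<close> by (rule ev_D_scalar[symmetric, OF _ U x])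
    moreover have "divergence u x = 0"
      using navier_stokes x by (auto simp: steady_navier_stokes_on_def)
    ultimately show "ev (\<Sum>j\<in>UNIV. D j (U j)) x = ev 0 x" by (simp add: divergence_def)
  qed
  have NS: "Lap (U i) = (\<Sum>j\<in>UNIV. U j * D j (U i)) + D i P" for i
  proof (rule sfun_eqI)
    fix x :: "real^3" assume x: "x \<noteq> 0"
    have "- laplacian u x + convection u u x + gradient p x = 0"
      using navier_stokes x by (auto simp: steady_navier_stokes_on_def)
    then have "(- laplacian u x + convection u u x + gradient p x) $ i = 0" by simp
    then show "ev (Lap (U i)) x = ev ((\<Sum>j\<in>UNIV. U j * D j (U i)) + D i P) x"
      using x by (simp add: Lap_def laplacian_def convection_def gradient_def DDU DU DP U)
  qed
  obtain \<alpha> c k where k: "k > 0" "k = \<alpha>\<^sup>2 - c \<bullet> c" and pos: "\<And>x. norm x = 1 \<Longrightarrow> \<alpha> + c \<bullet> x > 0"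
    and Ux: "\<And>x i. norm x = 1 \<Longrightarrow> ev (U i) x
      = - 2 * (\<alpha> * x $ i + c $ i) / (\<alpha> + c \<bullet> x) + 2 * k * x $ i / (\<alpha> + c \<bullet> x)\<^sup>2"
    using landau_formula[OF EU div NS] by blast
  have ux: "u x = (2 * k / (\<alpha> + c \<bullet> x)\<^sup>2 - 2 * \<alpha> / (\<alpha> + c \<bullet> x)) *\<^sub>R x - (2 / (\<alpha> + c \<bullet> x)) *\<^sub>R c"
    if x: "norm x = 1" for x
  proof -
    have "x \<noteq> 0" using x by auto
    then show ?thesis
      using Ux[OF x] by (simp add: vec_eq_iff U[symmetric] diff_divide_distrib add_divide_distrib algebra_simps)
  qed
  have scale: "u x = inverse (norm x) *\<^sub>R u (inverse (norm x) *\<^sub>R x)" if "x \<noteq> 0" for x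
    using homogeneous[of "inverse (norm x)" x] that by simp
  \<comment> \<open>The positive values at two antipodal points add up to
    \<open>2 * \<alpha>\<close>.\<close>
  have \<alpha>: "\<alpha> > 0" using pos[of "axis 1 1"] pos[of "- axis 1 1"] by simp
  \<comment> \<open>For \<open>c = 0\<close> one has \<open>k = \<alpha>\<^sup>2\<close>, and the
    two terms of \<open>u\<close> cancel: this is the excluded zero solution.\<close>
  have c0: "c \<noteq> 0"
  proof
    assume c: "c = 0"
    have "u x = 0" if "norm x = 1" for x
      using ux[OF that] k \<alpha> by (simp add: c power2_eq_square)
    then have "u x = 0" if "x \<noteq> 0" for x
      using scale[OF that] that by simp
    then show False using nonzero by blast
  qed
  \<comment> \<open>Since \<open>\<alpha>\<^sup>2 = s\<^sup>2 + \<beta>\<^sup>2\<close>, the pair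
    \<open>(\<alpha>, \<beta>)\<close> is \<open>s\<close> times
    \<open>(cosh \<kappa>, sinh \<kappa>)\<close>; the scale \<open>s\<close> cancels in
    \<open>u\<close>.\<close>
  define \<beta> s \<kappa> where "\<beta> = norm c" "s = sqrt k" "\<kappa> = arsinh (\<beta> / s)"
  have s: "s > 0" "s\<^sup>2 = k" using k by (auto simp: \<beta>_s_\<kappa>_def)
  have \<beta>: "\<beta> > 0" "c \<bullet> c = \<beta>\<^sup>2" using c0 by (auto simp: \<beta>_s_\<kappa>_def power2_norm_eq_inner)
  have sinh: "s * sinh \<kappa> = \<beta>" "sinh \<kappa> > 0" using s \<beta> by (simp_all add: \<beta>_s_\<kappa>_def)
  have cosh: "s * cosh \<kappa> = \<alpha>"
  proof -
    have "(s * cosh \<kappa>)\<^sup>2 = s\<^sup>2 + (s * sinh \<kappa>)\<^sup>2"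
      by (simp add: power_mult_distrib cosh_square_eq algebra_simps)
    also have "\<dots> = \<alpha>\<^sup>2" using k \<beta> by (simp add: sinh s)
    finally show ?thesis using s \<alpha> by (simp add: power2_eq_iff_nonneg)
  qed
  \<comment> \<open>The axis points against \<open>c\<close>, so that
    \<open>\<alpha> + c \<bullet> x\<close> becomes
    \<open>s * (cosh \<kappa> - sinh \<kappa> * cos \<theta>)\<close> with positive
    \<open>\<kappa>\<close>.\<close>
  obtain b where b: "orthonormal_frame b" "b 3 = (- 1 / \<beta>) *\<^sub>R c"
    using ex_orthonormal_frame[of "(- 1 / \<beta>) *\<^sub>R c"] \<beta> by (auto simp: \<beta>_s_\<kappa>_def)
  have c: "c = (- \<beta>) *\<^sub>R b 3" using \<beta> by (simp add: b(2))
  have bb: "b i \<bullet> b j = (if i = j then 1 else 0)" for i j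
    using b(1) by (simp add: orthonormal_frame_def)
  have "axisymmetric_about (b 3) u"
    unfolding axisymmetric_about_def
  proof (intro allI impI)
    fix Q :: "real^3^3" and x :: "real^3"
    assume Q: "rotation_matrix Q \<and> Q *v b 3 = b 3" and x: "x \<noteq> 0"
    \<comment> \<open>On the sphere \<open>u x\<close> is a combination of \<open>x\<close> and
      \<open>c\<close> with coefficients depending on \<open>c \<bullet> x\<close> alone, and a
      rotation fixing \<open>c\<close> respects all of this.\<close>
    have Qc: "Q *v c = c" using Q by (simp only: c matrix_vector_mult_scaleR)
    have Qi: "(Q *v x) \<bullet> (Q *v y) = x \<bullet> y" for x y using Q rotation_matrix_inner by blast
    have Qn: "norm (Q *v x) = norm x" for x by (simp add: norm_eq_sqrt_inner Qi)
    have Qx: "Q *v x \<noteq> 0" using Qn[of x] x by auto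
    define y where "y = inverse (norm x) *\<^sub>R x"
    have y: "norm y = 1" using x by (simp add: y_def)
    have cy: "c \<bullet> (Q *v y) = c \<bullet> y" using Qi[of c y] by (simp add: Qc)
    have "u (Q *v y) = Q *v u y"
      using ux[of "Q *v y"] ux[OF y] y
      by (simp add: Qn cy matrix_vector_mult_diff_distrib matrix_vector_mult_scaleR Qc)
    then show "u (Q *v x) = Q *v u x"
      using scale[OF x] scale[OF Qx] by (simp add: Qn y_def matrix_vector_mult_scaleR)
  qed
  moreover have "u x = (- 2 * sin \<theta> / (coth \<kappa> - cos \<theta>)) *\<^sub>R e_theta b \<theta> \<psi>
          + (2 / (cosh \<kappa> - sinh \<kappa> * cos \<theta>)\<^sup>2 - 2) *\<^sub>R x"
    if x: "norm x = 1" and sp: "x = spherical_point b \<theta> \<psi>" for x \<theta> \<psi>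
  proof -
    define d where "d = cosh \<kappa> - sinh \<kappa> * cos \<theta>"
    have "b 3 \<bullet> x = cos \<theta>" by (simp add: sp spherical_point_def inner_simps bb)
    then have dx: "\<alpha> + c \<bullet> x = s * d"
      unfolding d_def by (simp add: c cosh[symmetric] sinh(1)[symmetric] algebra_simps)
    then have d: "d > 0" using pos[OF x] s by (simp add: zero_less_mult_iff)
    \<comment> \<open>Written this way, as the tangential part of \<open>- b 3\<close>, the product
      also makes sense at the poles and does not depend on \<open>\<psi>\<close>.\<close>
    have e: "sin \<theta> *\<^sub>R e_theta b \<theta> \<psi> = cos \<theta> *\<^sub>R x - b 3"
    proof -
      have "(sin \<theta> * sin \<theta>) *\<^sub>R b 3 = (1 - cos \<theta> * cos \<theta>) *\<^sub>R b 3"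
        using sin_squared_eq[of \<theta>] by (simp add: power2_eq_square)
      then show ?thesis
        by (simp add: e_theta_eq sp spherical_point_def algebra_simps)
    qed
    have coth: "coth \<kappa> - cos \<theta> = d / sinh \<kappa>" using sinh by (simp add: coth_def d_def field_simps)
    have "(- 2 * sin \<theta> / (coth \<kappa> - cos \<theta>)) *\<^sub>R e_theta b \<theta> \<psi>
        = (- 2 * sinh \<kappa> / d) *\<^sub>R (sin \<theta> *\<^sub>R e_theta b \<theta> \<psi>)"
      by (simp add: coth)
    also have "\<dots> = (- 2 * sinh \<kappa> * cos \<theta> / d) *\<^sub>R x + (2 * sinh \<kappa> / d) *\<^sub>R b 3"
      unfolding e by (simp add: algebra_simps)
    also have "- 2 * sinh \<kappa> * cos \<theta> / d = 2 - 2 * cosh \<kappa> / d"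
      using d by (simp add: d_def field_simps)
    finally have rhs: "(- 2 * sin \<theta> / (coth \<kappa> - cos \<theta>)) *\<^sub>R e_theta b \<theta> \<psi> + (2 / d\<^sup>2 - 2) *\<^sub>R x
        = (2 / d\<^sup>2 - 2 * cosh \<kappa> / d) *\<^sub>R x + (2 * sinh \<kappa> / d) *\<^sub>R b 3"
      by (simp add: algebra_simps)
    have "u x = (2 * k / (s * d)\<^sup>2 - 2 * \<alpha> / (s * d)) *\<^sub>R x + (2 / (s * d) * \<beta>) *\<^sub>R b 3"
      unfolding ux[OF x] dx by (simp add: c)
    also have "\<dots> = (2 / d\<^sup>2 - 2 * cosh \<kappa> / d) *\<^sub>R x + (2 * sinh \<kappa> / d) *\<^sub>R b 3"
      using s d by (simp add: cosh[symmetric] sinh(1)[symmetric] power_mult_distrib s(2)[symmetric])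
    finally show ?thesis unfolding d_def[symmetric] rhs .
  qed
  moreover have "\<kappa> \<noteq> 0" using sinh(2) by auto
  ultimately show ?thesis using b(1) by (intro exI[of _ b] exI[of _ \<kappa>]) auto
qed

end
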